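(* Let $\triangle(q)=\sum_{n=0}^\infty q^{n(n+1)/2}$. For every integer $m\ge 1$ we have the identity of power series \[ q^{\frac{m^2}{2}}\,\triangle(q)^{4m^2}=\frac{2^m(2m)!}{\prod_{j=1}^m(2j)!^2}\sum_{\substack{x_j,y_j\in \frac12+\mathbb{Z}_{\ge 0}\\ 1\le j\le m}} f(\vec{\bm x})\,q^{2\sum_{j=1}^m x_jy_j}, \] where \[ f(\vec{\bm x})=\prod_{j=1}^m (x_j+y_j)\cdot\prod_{1\le i<j\le m}\Big((x_i-y_i)^2-(x_j-y_j)^2\Big)\Big((x_i+y_i)^2-(x_j+y_j)^2\Big). \]
   Context: Here $\vec{\bm x}$ denotes the tuple $(x_1,\dots,x_m,y_1,\dots,y_m)$ of summation variables; the sum runs over all $x_1,\dots,x_m,y_1,\dots,y_m\in\{1/2,3/2,5/2,\dots\}$. *)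

theory Defs
  imports
    "HOL-Computational_Algebra.Formal_Power_Series"
    "HOL-Library.FuncSet"
    "HOL-Analysis.Infinite_Sum"
begin

text \<open>
  Exponents of \<open>q\<close> are half-integers, so all series live in the ring of formal power series in
  \<open>t = q\<^sup>1\<^sup>/\<^sup>2\<close>, i.e. \<open>fps_X\<close> plays the role of \<open>t\<close>.  The monomial \<open>q\<^sup>r\<close> is \<open>t\<^sup>2\<^sup>r\<close>; this is
  meaningful for those \<open>r \<ge> 0\<close> with \<open>2 r\<close> an integer, and only such \<open>r\<close> are used.
  Infinite sums are taken in the \<open>t\<close>-adic topology of the type of formal power series.
\<close>

definition qpow :: "real \<Rightarrow> real fps" where
  "qpow r = fps_X ^ nat \<lfloor>2 * r\<rfloor>"

lemma qpow_half_of_nat: "qpow (real n / 2) = fps_X ^ n"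
  by (simp add: qpow_def)

lemma qpow_of_nat: "qpow (real n) = qpow 1 ^ n"
proof -
  have "\<lfloor>2 * real n\<rfloor> = int (2 * n)"
    by (metis floor_of_nat of_nat_mult of_nat_numeral)
  then show ?thesis by (simp add: qpow_def flip: power_mult)
qed

definition triangle_series :: "real fps \<Rightarrow> real fps" where
  "triangle_series q = (\<Sum>n. q ^ (n * (n + 1) div 2))"

definition half_odds :: "real set" where
  "half_odds = {1/2 + real n | n. True}"

text \<open>
  The tuples \<open>(x\<^sub>1, \<dots>, x\<^sub>m)\<close> with entries in \<open>half_odds\<close> are the extensional functions
  on \<open>{1..m}\<close>, so that each tuple is represented exactly once.
\<close>

definition half_odd_tuples :: "nat \<Rightarrow> (nat \<Rightarrow> real) set" where
  "half_odd_tuples m = ({1..m} \<rightarrow>\<^sub>E half_odds)"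

definition f_weight :: "nat \<Rightarrow> (nat \<Rightarrow> real) \<Rightarrow> (nat \<Rightarrow> real) \<Rightarrow> real" where
  "f_weight m x y = (\<Prod>j=1..m. x j + y j) *
     (\<Prod>i=1..m. \<Prod>j=i+1..m.
        ((x i - y i)\<^sup>2 - (x j - y j)\<^sup>2) * ((x i + y i)\<^sup>2 - (x j + y j)\<^sup>2))"

lemma half_odd_exponent:
  assumes "x \<in> half_odd_tuples m" "y \<in> half_odd_tuples m"
  shows "\<exists>n. 2 * (\<Sum>j=1..m. x j * y j) = real n / 2"
proof -
  have "\<exists>n. 4 * (x j * y j) = real n" if "j \<in> {1..m}" for j
  proof -
    have "x j \<in> half_odds" "y j \<in> half_odds"
      using assms that by (auto simp: half_odd_tuples_def)
    then obtain a b where "x j = 1/2 + real a" "y j = 1/2 + real b"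
      by (auto simp: half_odds_def)
    then have "4 * (x j * y j) = real ((1 + 2 * a) * (1 + 2 * b))"
      by (simp add: algebra_simps)
    then show ?thesis ..
  qed
  then obtain h where h: "\<And>j. j \<in> {1..m} \<Longrightarrow> 4 * (x j * y j) = real (h j)"
    by metis
  have "4 * (\<Sum>j=1..m. x j * y j) = (\<Sum>j=1..m. real (h j))"
    unfolding sum_distrib_left using h by (intro sum.cong) auto
  then have "2 * (\<Sum>j=1..m. x j * y j) = real (\<Sum>j=1..m. h j) / 2"
    by simp
  then show ?thesis ..
qed

end

theory Submission
  imports
    Defs
    "HOL-Computational_Algebra.Formal_Laurent_Series"
    "Jordan_Normal_Form.Determinant"
begin

text \<open>
  Write \<open>t = q\<^sup>1\<^sup>/\<^sup>2\<close>, \<open>n = x - y\<close>, \<open>N = x + y\<close>.  By Vandermonde and Andreief the sum is \<open>m!\<close> times the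
  determinant of the moments \<open>\<Sum> n\<^sup>2\<^sup>i N\<^sup>2\<^sup>j\<^sup>+\<^sup>1 t\<^sup>4\<^sup>x\<^sup>y\<close>, which are the Taylor coefficients of
  \<open>F(u, v) = \<Sum> cosh(n u) sinh(N v) t\<^sup>4\<^sup>x\<^sup>y\<close>.  Let \<open>A(u)\<close> and \<open>B(u)\<close> be the sums of
  \<open>t^(r\<^sup>2) exp(r u)\<close> over the even and the odd integers \<open>r\<close>.  Sign-reversing involutions show that
  \<open>2 F(u, v) (A(u) A(v) - B(u) B(v))\<close> is the Wronskian \<open>A(v) B'(v) - B(v) A'(v)\<close>, independent of \<open>u\<close>.
  After a linear change of \<open>A\<close> and \<open>B\<close> this reads \<open>2 F(u, v) = P(u) R(v) / (1 - S(u) S(v))\<close> with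
  \<open>S = s u\<^sup>2 + \<dots>\<close>, \<open>P = 1 + \<dots>\<close> and \<open>R = 2 s v + \<dots>\<close>; expanding the geometric series is an LU decomposition
  of the moment matrix, so its determinant is \<open>s^(m\<^sup>2)\<close>, where \<open>s = \<Sum> (x + y) t\<^sup>4\<^sup>x\<^sup>y\<close>.

  It remains to see \<open>s = t \<triangle>(t\<^sup>2)\<^sup>4\<close>.  The lowest coefficient of the same identity expresses \<open>s\<close> through
  the Wronskian, with respect to \<open>t d/dt\<close>, of the theta constants \<open>A(0)\<close> and \<open>B(0)\<close>, which obey the
  recursion of the arithmetic-geometric mean under \<open>t \<mapsto> t\<^sup>2\<close>.  Hence \<open>s\<close> and \<open>t \<triangle>(t\<^sup>2)\<^sup>4\<close> satisfy the same
  linear equation relating a series to its image under \<open>t \<mapsto> t\<^sup>2\<close>, and their lowest coefficients agree.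
\<close>

no_notation vec_index (infixl "$" 100)

section \<open>Sums of monomials indexed by a set\<close>

definition nonneg_finite_fibres :: "'i set \<Rightarrow> ('i \<Rightarrow> int) \<Rightarrow> bool" where
  "nonneg_finite_fibres I e \<longleftrightarrow> (\<forall>i\<in>I. 0 \<le> e i) \<and> (\<forall>n. finite {i\<in>I. e i \<le> n})"

lemma exponent_nonneg: "nonneg_finite_fibres I e \<Longrightarrow> i \<in> I \<Longrightarrow> 0 \<le> e i"
  unfolding nonneg_finite_fibres_def by auto

lemma finite_sublevel: "nonneg_finite_fibres I e \<Longrightarrow> finite {i\<in>I. e i \<le> n}"
  unfolding nonneg_finite_fibres_def by auto

lemma finite_fibre: "nonneg_finite_fibres I e \<Longrightarrow> finite {i\<in>I. e i = n}"
  by (rule finite_subset[OF _ finite_sublevel[of I e n]]) auto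

lemma nonneg_finite_fibres_subset:
  "nonneg_finite_fibres I e \<Longrightarrow> J \<subseteq> I \<Longrightarrow> nonneg_finite_fibres J e"
  unfolding nonneg_finite_fibres_def by (auto intro: finite_subset[rotated])

lemma nonneg_finite_fibres_Un:
  "nonneg_finite_fibres I e \<Longrightarrow> nonneg_finite_fibres J e \<Longrightarrow> nonneg_finite_fibres (I \<union> J) e"
  unfolding nonneg_finite_fibres_def by (auto simp: Collect_disj_eq conj_disj_distribR)

lemma nonneg_finite_fibres_bound:
  assumes fin: "nonneg_finite_fibres J e'" and f: "inj_on f I" "\<And>i. i \<in> I \<Longrightarrow> f i \<in> J"
    and nonneg: "\<And>i. i \<in> I \<Longrightarrow> 0 \<le> e i"
    and bound: "\<And>i. i \<in> I \<Longrightarrow> e' (f i) \<le> c * e i + d" and c: "0 \<le> c"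
  shows "nonneg_finite_fibres I e"
  unfolding nonneg_finite_fibres_def
proof (intro conjI allI ballI nonneg)
  fix n
  have "f ` {i\<in>I. e i \<le> n} \<subseteq> {j\<in>J. e' j \<le> c * n + d}"
  proof (rule image_subsetI)
    fix i assume "i \<in> {i\<in>I. e i \<le> n}"
    then have "i \<in> I" "c * e i \<le> c * n" using c by (auto intro: mult_left_mono)
    with bound[of i] f(2) show "f i \<in> {j\<in>J. e' j \<le> c * n + d}" by auto
  qed
  then have "finite (f ` {i\<in>I. e i \<le> n})"
    using finite_sublevel[OF fin] by (rule finite_subset)
  then show "finite {i\<in>I. e i \<le> n}"
    by (rule finite_imageD) (rule inj_on_subset[OF f(1)], auto)
qed

lemma nonneg_finite_fibres_abs: "nonneg_finite_fibres UNIV (abs :: int \<Rightarrow> int)"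
proof -
  have "{k. \<bar>k\<bar> \<le> n} = {- n..n}" for n :: int by auto
  then show ?thesis by (simp add: nonneg_finite_fibres_def)
qed

lemma nonneg_finite_fibres_cmult:
  assumes "nonneg_finite_fibres I e" "0 < c"
  shows "nonneg_finite_fibres I (\<lambda>i. c * e i)"
proof (rule nonneg_finite_fibres_bound[OF assms(1), where f = id and c = 1 and d = 0])
  fix i assume "i \<in> I"
  then have "0 \<le> e i" by (rule exponent_nonneg[OF assms(1)])
  with assms(2) show "0 \<le> c * e i" "e (id i) \<le> 1 * (c * e i) + 0"
    using mult_right_mono[of 1 c "e i"] by auto
qed auto

lemma nonneg_finite_fibres_Times:
  assumes "nonneg_finite_fibres I e" "nonneg_finite_fibres J e'"
  shows "nonneg_finite_fibres (I \<times> J) (\<lambda>(i, j). e i + e' j)"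
  unfolding nonneg_finite_fibres_def
proof (intro conjI allI ballI)
  fix n
  have "{p \<in> I \<times> J. (case p of (i, j) \<Rightarrow> e i + e' j) \<le> n}
      \<subseteq> {i\<in>I. e i \<le> n} \<times> {j\<in>J. e' j \<le> n}"
    using exponent_nonneg[OF assms(1)] exponent_nonneg[OF assms(2)] by fastforce
  then show "finite {p \<in> I \<times> J. (case p of (i, j) \<Rightarrow> e i + e' j) \<le> n}"
    by (rule finite_subset) (use assms in \<open>auto intro: finite_sublevel\<close>)
qed (use exponent_nonneg[OF assms(1)] exponent_nonneg[OF assms(2)] in fastforce)

lemma nonneg_finite_fibres_PiE:
  assumes "finite A" "nonneg_finite_fibres I e"
  shows "nonneg_finite_fibres (A \<rightarrow>\<^sub>E I) (\<lambda>z. \<Sum>a\<in>A. e (z a))"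
  unfolding nonneg_finite_fibres_def
proof (intro conjI allI ballI)
  fix n
  have "z a \<in> {i\<in>I. e i \<le> n}" if "z \<in> A \<rightarrow>\<^sub>E I" "(\<Sum>a\<in>A. e (z a)) \<le> n" "a \<in> A" for z a
  proof -
    have "e (z a) \<le> (\<Sum>a\<in>A. e (z a))"
      by (rule member_le_sum) (use that assms exponent_nonneg[OF assms(2)] in auto)
    with that show ?thesis by auto
  qed
  then have "{z \<in> A \<rightarrow>\<^sub>E I. (\<Sum>a\<in>A. e (z a)) \<le> n} \<subseteq> A \<rightarrow>\<^sub>E {i\<in>I. e i \<le> n}"
    by (fastforce simp: PiE_def Pi_def)
  then show "finite {z \<in> A \<rightarrow>\<^sub>E I. (\<Sum>a\<in>A. e (z a)) \<le> n}"
    by (rule finite_subset) (intro finite_PiE assms finite_sublevel)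
qed (use exponent_nonneg[OF assms(2)] in \<open>auto intro!: sum_nonneg\<close>)

text \<open>Meaningful only if \<open>nonneg_finite_fibres I e\<close>: other terms are silently dropped.\<close>

definition qsum :: "'i set \<Rightarrow> ('i \<Rightarrow> int) \<Rightarrow> ('i \<Rightarrow> 'a::comm_monoid_add) \<Rightarrow> 'a fps" where
  "qsum I e w = Abs_fps (\<lambda>n. \<Sum>i | i \<in> I \<and> e i = int n. w i)"

lemma qsum_nth: "qsum I e w $ n = (\<Sum>i | i \<in> I \<and> e i = int n. w i)"
  by (simp add: qsum_def)

lemma has_sum_qsum:
  fixes w :: "'i \<Rightarrow> 'a::comm_ring_1"
  assumes "nonneg_finite_fibres I e"
  shows "((\<lambda>i. fps_const (w i) * fps_X ^ nat (e i)) has_sum qsum I e w) I"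
  unfolding has_sum_def tendsto_fps_iff
proof
  fix n
  show "\<forall>\<^sub>F F in finite_subsets_at_top I.
      (\<Sum>i\<in>F. fps_const (w i) * fps_X ^ nat (e i)) $ n = qsum I e w $ n"
    unfolding eventually_finite_subsets_at_top
  proof (intro exI[of _ "{i\<in>I. e i = int n}"] conjI allI impI)
    show "finite {i\<in>I. e i = int n}" by (rule finite_fibre[OF assms])
    fix F assume F: "finite F \<and> {i\<in>I. e i = int n} \<subseteq> F \<and> F \<subseteq> I"
    have "(\<Sum>i\<in>F. fps_const (w i) * fps_X ^ nat (e i)) $ n
        = (\<Sum>i\<in>F. if e i = int n then w i else 0)"
      unfolding fps_sum_nth
      by (intro sum.cong refl) (use exponent_nonneg[OF assms] F in \<open>auto simp: fps_X_power_iff\<close>)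
    also have "\<dots> = qsum I e w $ n"
      unfolding qsum_nth by (rule sum.mono_neutral_cong_right) (use F in auto)
    finally show "(\<Sum>i\<in>F. fps_const (w i) * fps_X ^ nat (e i)) $ n = qsum I e w $ n" .
  qed auto
qed

lemma qsum_cong:
  assumes "\<And>i. i \<in> I \<Longrightarrow> e i = e' i" "\<And>i. i \<in> I \<Longrightarrow> w i = w' i"
  shows "qsum I e w = qsum I e' w'"
  unfolding qsum_def by (intro arg_cong[where f = Abs_fps] ext sum.cong) (use assms in auto)

lemma qsum_reindex:
  assumes "bij_betw f I J"
    and "\<And>i. i \<in> I \<Longrightarrow> e' (f i) = e i" "\<And>i. i \<in> I \<Longrightarrow> w' (f i) = w i"
  shows "qsum I e w = qsum J e' w'"
proof (rule fps_ext)
  fix n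
  have bij: "bij_betw f {i\<in>I. e i = int n} {j\<in>J. e' j = int n}"
    using assms(1,2) by (auto simp: bij_betw_def inj_on_def)
  show "qsum I e w $ n = qsum J e' w' $ n"
    unfolding qsum_nth sum.reindex_bij_betw[OF bij, of w', symmetric]
    by (rule sum.cong) (use assms(3) in auto)
qed

lemma qsum_zero [simp]: "qsum I e (\<lambda>_. 0) = 0"
  by (simp add: fps_eq_iff qsum_nth)

lemma qsum_uminus:
  fixes w :: "'i \<Rightarrow> 'a::ab_group_add"
  shows "qsum I e (\<lambda>i. - w i) = - qsum I e w"
  by (simp add: fps_eq_iff qsum_nth sum_negf)

lemma qsum_diff:
  fixes w w' :: "'i \<Rightarrow> 'a::ab_group_add"
  shows "qsum I e (\<lambda>i. w i - w' i) = qsum I e w - qsum I e w'"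
  by (simp add: fps_eq_iff qsum_nth sum_subtractf)

lemma qsum_cmult:
  fixes w :: "'i \<Rightarrow> 'a::comm_ring_1"
  shows "qsum I e (\<lambda>i. c * w i) = fps_const c * qsum I e w"
  by (simp add: fps_eq_iff qsum_nth sum_distrib_left)

lemma qsum_sum: "qsum I e (\<lambda>i. \<Sum>k\<in>K. w k i) = (\<Sum>k\<in>K. qsum I e (w k))"
  by (simp add: fps_eq_iff qsum_nth fps_sum_nth sum.swap[of _ K])

lemma qsum_Un_disjoint:
  assumes "nonneg_finite_fibres (I \<union> J) e" "I \<inter> J = {}"
  shows "qsum (I \<union> J) e w = qsum I e w + qsum J e w"
proof (rule fps_ext)
  fix n
  have "{i \<in> I \<union> J. e i = int n} = {i\<in>I. e i = int n} \<union> {i\<in>J. e i = int n}" by auto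
  then show "qsum (I \<union> J) e w $ n = (qsum I e w + qsum J e w) $ n"
    using finite_fibre[OF assms(1), of n] assms(2)
    by (auto simp: qsum_nth intro!: sum.union_disjoint)
qed

lemma qsum_mono_neutral:
  assumes "nonneg_finite_fibres I e" "J \<subseteq> I" "\<And>i. i \<in> I - J \<Longrightarrow> w i = 0"
  shows "qsum I e w = qsum J e w"
  by (rule fps_ext, unfold qsum_nth, rule sum.mono_neutral_right)
    (use assms finite_fibre[OF assms(1)] in auto)

lemma qsum_of_bool:
  fixes w :: "'i \<Rightarrow> 'a::comm_ring_1"
  assumes "nonneg_finite_fibres I e"
  shows "qsum I e (\<lambda>i. of_bool (P i) * w i) = qsum {i\<in>I. P i} e w"
proof -
  have "qsum I e (\<lambda>i. of_bool (P i) * w i) = qsum {i\<in>I. P i} e (\<lambda>i. of_bool (P i) * w i)"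
    by (rule qsum_mono_neutral[OF assms]) auto
  also have "\<dots> = qsum {i\<in>I. P i} e w" by (rule qsum_cong) auto
  finally show ?thesis .
qed

lemma qsum_involution_eq_0:
  fixes w :: "'i \<Rightarrow> 'a::{idom, semiring_char_0}"
  assumes "\<And>i. i \<in> I \<Longrightarrow> f i \<in> I" "\<And>i. i \<in> I \<Longrightarrow> f (f i) = i"
    and "\<And>i. i \<in> I \<Longrightarrow> e (f i) = e i" "\<And>i. i \<in> I \<Longrightarrow> w (f i) = - w i"
  shows "qsum I e w = 0"
proof -
  have bij: "bij_betw f I I"
    by (rule bij_betw_byWitness[where f' = f]) (use assms in auto)
  have "qsum I e w = qsum I e (\<lambda>i. - w i)"
    by (rule qsum_reindex[OF bij]) (use assms in auto)
  then show ?thesis by (simp add: qsum_uminus)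
qed

lemma qsum_fibres:
  assumes "nonneg_finite_fibres I e" "nonneg_finite_fibres J e'"
    and "\<And>i. i \<in> I \<Longrightarrow> f i \<in> J" "\<And>i. i \<in> I \<Longrightarrow> e' (f i) = e i"
  shows "qsum I e w = qsum J e' (\<lambda>j. \<Sum>i | i \<in> I \<and> f i = j. w i)"
proof (rule fps_ext)
  fix n
  have "qsum I e w $ n =
      (\<Sum>j | j \<in> J \<and> e' j = int n. \<Sum>i\<in>{i\<in>{i\<in>I. e i = int n}. f i = j}. w i)"
    unfolding qsum_nth
    by (rule sum.group[symmetric])
      (use assms finite_fibre[OF assms(1)] finite_fibre[OF assms(2)] in auto)
  also have "\<dots> = qsum J e' (\<lambda>j. \<Sum>i | i \<in> I \<and> f i = j. w i) $ n"
    unfolding qsum_nth by (intro sum.cong refl) (use assms(4) in auto)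
  finally show "qsum I e w $ n = \<dots>" .
qed

lemma qsum_mult:
  fixes w :: "'i \<Rightarrow> 'a::comm_ring_1" and w' :: "'j \<Rightarrow> 'a"
  assumes "nonneg_finite_fibres I e" "nonneg_finite_fibres J e'"
  shows "qsum I e w * qsum J e' w' =
    qsum (I \<times> J) (\<lambda>(i, j). e i + e' j) (\<lambda>(i, j). w i * w' j)"
proof (rule fps_ext)
  fix n
  let ?I = "\<lambda>k. {i\<in>I. e i = int k}" and ?J = "\<lambda>k. {j\<in>J. e' j = int k}"
  have fibre: "{p. p \<in> I \<times> J \<and> (case p of (i, j) \<Rightarrow> e i + e' j) = int n}
      = (\<Union>k\<in>{0..n}. ?I k \<times> ?J (n - k))" (is "?L = ?R")
  proof (intro equalityI subsetI)
    fix p assume "p \<in> ?L"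
    then obtain i j where p: "p = (i, j)" "i \<in> I" "j \<in> J" "e i + e' j = int n" by auto
    then have "0 \<le> e i" "0 \<le> e' j"
      using exponent_nonneg[OF assms(1)] exponent_nonneg[OF assms(2)] by auto
    with p show "p \<in> ?R" by (intro UN_I[of "nat (e i)"]) auto
  qed auto
  have "(qsum I e w * qsum J e' w') $ n
      = (\<Sum>k=0..n. \<Sum>(i, j)\<in>?I k \<times> ?J (n - k). w i * w' j)"
    by (simp add: fps_mult_nth qsum_nth sum_product sum.cartesian_product)
  also have "\<dots> = (\<Sum>(i, j)\<in>(\<Union>k\<in>{0..n}. ?I k \<times> ?J (n - k)). w i * w' j)"
    by (rule sum.UNION_disjoint[symmetric])
      (auto intro: finite_fibre[OF assms(1)] finite_fibre[OF assms(2)])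
  finally show "(qsum I e w * qsum J e' w') $ n =
      qsum (I \<times> J) (\<lambda>(i, j). e i + e' j) (\<lambda>(i, j). w i * w' j) $ n"
    by (simp add: qsum_nth fibre)
qed

lemma prod_qsum:
  fixes w :: "'b \<Rightarrow> 'i \<Rightarrow> 'a::comm_ring_1"
  assumes "finite A" "nonneg_finite_fibres I e"
  shows "(\<Prod>a\<in>A. qsum I e (w a)) =
    qsum (A \<rightarrow>\<^sub>E I) (\<lambda>z. \<Sum>a\<in>A. e (z a)) (\<lambda>z. \<Prod>a\<in>A. w a (z a))"
  using assms(1)
proof induction
  case empty
  show ?case by (auto simp: fps_eq_iff qsum_nth)
next
  case (insert b A)
  let ?extend = "\<lambda>(i, z). z(b := i)"
  have bij: "bij_betw ?extend (I \<times> (A \<rightarrow>\<^sub>E I)) (insert b A \<rightarrow>\<^sub>E I)"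
    using inj_combinator[of b A "\<lambda>_. I"] insert.hyps
    by (auto simp: bij_betw_def PiE_insert_eq)
  have "(\<Prod>a\<in>insert b A. qsum I e (w a)) = qsum I e (w b) *
      qsum (A \<rightarrow>\<^sub>E I) (\<lambda>z. \<Sum>a\<in>A. e (z a)) (\<lambda>z. \<Prod>a\<in>A. w a (z a))"
    using insert by simp
  also have "\<dots> = qsum (I \<times> (A \<rightarrow>\<^sub>E I)) (\<lambda>(i, z). e i + (\<Sum>a\<in>A. e (z a)))
      (\<lambda>(i, z). w b i * (\<Prod>a\<in>A. w a (z a)))"
    by (rule qsum_mult) (use assms(2) insert.hyps in \<open>auto intro: nonneg_finite_fibres_PiE\<close>)
  also have "\<dots> = qsum (insert b A \<rightarrow>\<^sub>E I) (\<lambda>z. \<Sum>a\<in>insert b A. e (z a))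
      (\<lambda>z. \<Prod>a\<in>insert b A. w a (z a))"
    by (rule qsum_reindex[OF bij])
      (use insert.hyps in \<open>auto intro!: sum.cong prod.cong arg_cong2[where f = "(*)"]\<close>)
  finally show ?case .
qed

lemma fps_X_power_mult_qsum:
  fixes w :: "'i \<Rightarrow> 'a::comm_ring_1"
  assumes "nonneg_finite_fibres I e"
  shows "fps_X ^ c * qsum I e w = qsum I (\<lambda>i. int c + e i) w"
proof (rule fps_ext)
  fix n
  show "(fps_X ^ c * qsum I e w) $ n = qsum I (\<lambda>i. int c + e i) w $ n"
  proof (cases "n < c")
    case True
    then have "{i. i \<in> I \<and> int c + e i = int n} = {}"
      using exponent_nonneg[OF assms] by force
    with True show ?thesis by (simp only: fps_X_power_mult_nth qsum_nth if_True sum.empty)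
  next
    case False
    then have "{i. i \<in> I \<and> int c + e i = int n} = {i. i \<in> I \<and> e i = int (n - c)}" by auto
    with False show ?thesis by (simp add: fps_X_power_mult_nth qsum_nth)
  qed
qed

lemma fps_XD_qsum:
  fixes w :: "'i \<Rightarrow> 'a::comm_ring_1"
  shows "fps_XD (qsum I e w) = qsum I e (\<lambda>i. of_int (e i) * w i)"
  by (simp add: fps_eq_iff fps_XD_nth qsum_nth sum_distrib_left)

lemma qsum_compose_X_power:
  fixes w :: "'i \<Rightarrow> 'a::comm_ring_1"
  assumes "c > 0"
  shows "qsum I e w oo fps_X ^ c = qsum I (\<lambda>i. int c * e i) w"
proof (rule fps_ext)
  fix n
  show "(qsum I e w oo fps_X ^ c) $ n = qsum I (\<lambda>i. int c * e i) w $ n"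
  proof (cases "c dvd n")
    case True
    then obtain k where "n = c * k" ..
    with assms show ?thesis by (simp add: fps_nth_compose_X_power qsum_nth)
  next
    case False
    have "int c * e i \<noteq> int n" for i
      using False by (metis dvd_triv_left int_dvd_int_iff)
    with False show ?thesis by (simp add: fps_nth_compose_X_power qsum_nth)
  qed
qed

section \<open>Theta constants\<close>

definition theta_squares :: "nat \<Rightarrow> real fps" where
  "theta_squares c = qsum UNIV (\<lambda>k. int c * k\<^sup>2) (\<lambda>_. 1)"

definition theta_pronics :: "nat \<Rightarrow> real fps" where
  "theta_pronics c = qsum UNIV (\<lambda>k. int c * (k\<^sup>2 + k)) (\<lambda>_. 1)"

lemma abs_le_square_int: "\<bar>k\<bar> \<le> (k::int)\<^sup>2"
  using self_le_power[of "\<bar>k\<bar>" 2] by (cases "k = 0") auto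

lemma pronic_nonneg_int: "0 \<le> (k::int)\<^sup>2 + k"
  using abs_le_square_int[of k] by linarith

lemma nonneg_finite_fibres_square: "nonneg_finite_fibres I (\<lambda>k::int. k\<^sup>2)"
  by (rule nonneg_finite_fibres_bound[OF nonneg_finite_fibres_abs,
        where f = id and c = 1 and d = 0])
    (simp_all add: abs_le_square_int)

lemma nonneg_finite_fibres_pronic: "nonneg_finite_fibres I (\<lambda>k::int. k\<^sup>2 + k)"
proof (rule nonneg_finite_fibres_bound[OF nonneg_finite_fibres_square,
      where J = UNIV and f = "\<lambda>k. 2 * k + 1" and c = 4 and d = 1])
  fix k :: int
  show "(2 * k + 1)\<^sup>2 \<le> 4 * (k\<^sup>2 + k) + 1" by (simp add: power2_eq_square algebra_simps)
qed (auto simp: inj_on_def pronic_nonneg_int)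

lemmas nonneg_finite_fibres_theta =
  nonneg_finite_fibres_cmult[OF nonneg_finite_fibres_square[of UNIV]]
  nonneg_finite_fibres_cmult[OF nonneg_finite_fibres_pronic[of UNIV]]

lemma bij_betw_int_pairs_even:
  "bij_betw (\<lambda>(r, s). (r + s, r - s)) UNIV {(k, l :: int). even (k + l)}"
  by (rule bij_betw_byWitness[where f' = "\<lambda>(k, l). ((k + l) div 2, (k - l) div 2)"])
    (auto elim!: evenE; presburger)+

lemma bij_betw_int_pairs_odd:
  "bij_betw (\<lambda>(r, s). (r + s + 1, r - s)) UNIV {(k, l :: int). odd (k + l)}"
  by (rule bij_betw_byWitness[where f' = "\<lambda>(k, l). ((k + l) div 2, (k - l) div 2)"])
    (auto elim!: oddE; presburger)+

lemma qsum_int_pairs_parity: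
  assumes "nonneg_finite_fibres UNIV e"
  shows "qsum UNIV e w =
    qsum UNIV (\<lambda>(r, s). e (r + s, r - s)) (\<lambda>(r, s). w (r + s, r - s)) +
    qsum UNIV (\<lambda>(r, s). e (r + s + 1, r - s)) (\<lambda>(r, s). w (r + s + 1, r - s :: int))"
proof -
  let ?E = "{(k, l :: int). even (k + l)}" and ?O = "{(k, l :: int). odd (k + l)}"
  have split: "UNIV = ?E \<union> ?O" by auto
  have "qsum (?E \<union> ?O) e w = qsum ?E e w + qsum ?O e w"
    by (rule qsum_Un_disjoint) (use assms split in auto)
  also have "qsum ?E e w = qsum UNIV (\<lambda>(r, s). e (r + s, r - s)) (\<lambda>(r, s). w (r + s, r - s))"
    by (rule qsum_reindex[OF bij_betw_int_pairs_even, symmetric]) auto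
  also have "qsum ?O e w =
      qsum UNIV (\<lambda>(r, s). e (r + s + 1, r - s)) (\<lambda>(r, s). w (r + s + 1, r - s))"
    by (rule qsum_reindex[OF bij_betw_int_pairs_odd, symmetric]) auto
  finally show ?thesis using split by simp
qed

lemma theta_squares_power2:
  assumes "c > 0"
  shows "(theta_squares c)\<^sup>2 = (theta_squares (2 * c))\<^sup>2 + fps_X ^ c * (theta_pronics (2 * c))\<^sup>2"
proof -
  let ?e = "\<lambda>(k, l). int c * k\<^sup>2 + int c * l\<^sup>2"
  have fin: "nonneg_finite_fibres UNIV ?e"
    using nonneg_finite_fibres_Times[OF nonneg_finite_fibres_theta(1) nonneg_finite_fibres_theta(1)]
      assms by simp
  have "(theta_squares c)\<^sup>2 = qsum UNIV ?e (\<lambda>_. 1)"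
    unfolding theta_squares_def power2_eq_square[of "qsum _ _ _"] using assms
    by (subst qsum_mult) (auto intro!: nonneg_finite_fibres_theta qsum_cong)
  also have "\<dots> = qsum UNIV (\<lambda>(r, s). int (2 * c) * r\<^sup>2 + int (2 * c) * s\<^sup>2) (\<lambda>_. 1) +
      qsum UNIV (\<lambda>(r, s). int c + (int (2 * c) * (r\<^sup>2 + r) + int (2 * c) * (s\<^sup>2 + s))) (\<lambda>_. 1)"
    unfolding qsum_int_pairs_parity[OF fin]
    by (intro arg_cong2[where f = "(+)"] qsum_cong) (auto simp: power2_eq_square algebra_simps)
  also have "qsum UNIV (\<lambda>(r, s). int (2 * c) * r\<^sup>2 + int (2 * c) * s\<^sup>2) (\<lambda>_. 1) =
      (theta_squares (2 * c))\<^sup>2"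
    unfolding theta_squares_def power2_eq_square[of "qsum _ _ _"] using assms
    by (subst qsum_mult) (auto intro!: nonneg_finite_fibres_theta qsum_cong)
  also have "qsum UNIV (\<lambda>(r, s). int c + (int (2 * c) * (r\<^sup>2 + r) + int (2 * c) * (s\<^sup>2 + s)))
      (\<lambda>_. 1) = fps_X ^ c * (theta_pronics (2 * c))\<^sup>2"
    unfolding theta_pronics_def power2_eq_square[of "qsum _ _ _"] using assms
    by (subst qsum_mult, (auto intro!: nonneg_finite_fibres_theta)[2], subst fps_X_power_mult_qsum)
      (auto intro!: nonneg_finite_fibres_Times nonneg_finite_fibres_theta qsum_cong
        simp flip: UNIV_Times_UNIV)
  finally show ?thesis .
qed

lemma theta_pronics_power2:
  assumes "c > 0"
  shows "(theta_pronics c)\<^sup>2 = 2 * theta_pronics (2 * c) * theta_squares (2 * c)"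
proof -
  let ?e = "\<lambda>(k, l). int c * (k\<^sup>2 + k) + int c * (l\<^sup>2 + l)"
  let ?e' = "\<lambda>(r, s). int (2 * c) * (r\<^sup>2 + r) + int (2 * c) * s\<^sup>2"
  have fin: "nonneg_finite_fibres UNIV ?e"
    using nonneg_finite_fibres_Times[OF nonneg_finite_fibres_theta(2) nonneg_finite_fibres_theta(2)]
      assms by simp
  have "(theta_pronics c)\<^sup>2 = qsum UNIV ?e (\<lambda>_. 1)"
    unfolding theta_pronics_def power2_eq_square[of "qsum _ _ _"] using assms
    by (subst qsum_mult) (auto intro!: nonneg_finite_fibres_theta qsum_cong)
  also have "\<dots> = qsum UNIV ?e' (\<lambda>_. 1) +
      qsum UNIV (\<lambda>(r, s). int (2 * c) * (r + 1)\<^sup>2 + int (2 * c) * (s\<^sup>2 + s)) (\<lambda>_. 1)"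
    unfolding qsum_int_pairs_parity[OF fin]
    by (intro arg_cong2[where f = "(+)"] qsum_cong) (auto simp: power2_eq_square algebra_simps)
  also have "qsum UNIV (\<lambda>(r, s). int (2 * c) * (r + 1)\<^sup>2 + int (2 * c) * (s\<^sup>2 + s)) (\<lambda>_. 1) =
      qsum UNIV ?e' (\<lambda>_. 1 :: real)"
  proof (rule qsum_reindex)
    show "bij_betw (\<lambda>(r, s). (s, r + 1)) UNIV (UNIV :: (int \<times> int) set)"
      by (rule bij_betw_byWitness[where f' = "\<lambda>(s, r). (r - 1, s)"]) auto
  qed (auto simp: algebra_simps)
  also have "qsum UNIV ?e' (\<lambda>_. 1) = theta_pronics (2 * c) * theta_squares (2 * c)"
    unfolding theta_pronics_def theta_squares_def using assms
    by (subst qsum_mult) (auto intro!: nonneg_finite_fibres_theta qsum_cong)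
  finally show ?thesis by simp
qed

lemma theta_squares_compose_X_power:
  "d > 0 \<Longrightarrow> theta_squares c oo fps_X ^ d = theta_squares (d * c)"
  by (simp add: theta_squares_def qsum_compose_X_power mult.assoc)

lemma theta_pronics_compose_X_power:
  "d > 0 \<Longrightarrow> theta_pronics c oo fps_X ^ d = theta_pronics (d * c)"
  by (simp add: theta_pronics_def qsum_compose_X_power mult.assoc)

lemma theta_squares_nth_0: "c > 0 \<Longrightarrow> theta_squares c $ 0 = 1"
  by (simp add: theta_squares_def qsum_nth)

lemma theta_pronics_nth_0:
  assumes "c > 0"
  shows "theta_pronics c $ 0 = 2"
proof -
  have "k\<^sup>2 + k = k * (k + 1)" for k :: int by (simp add: power2_eq_square algebra_simps)
  then have "{k :: int. int c * (k\<^sup>2 + k) = 0} = {0, - 1}" using assms by auto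
  then show ?thesis by (simp add: theta_pronics_def qsum_nth del: mult_eq_0_iff)
qed

lemma theta_pronics_eq_triangle_series: "theta_pronics 1 = 2 * triangle_series (qpow 1)"
proof -
  let ?e = "\<lambda>k::int. k\<^sup>2 + k" and ?T = "qsum {0..} (\<lambda>k::int. k\<^sup>2 + k) (\<lambda>_. 1) :: real fps"
  have bij_betw_int_nonneg: "bij_betw int UNIV {0..}"
    by (rule bij_betw_byWitness[where f' = nat]) auto
  have "((\<lambda>k. fps_X ^ nat (?e k)) has_sum ?T) {0..}"
    using has_sum_qsum[OF nonneg_finite_fibres_pronic[of "{0..}"], where w = "\<lambda>_. 1 :: real"]
    by simp
  then have "((\<lambda>n. fps_X ^ nat (?e (int n))) has_sum ?T) UNIV"
    by (rule has_sum_reindex_bij_betw[OF bij_betw_int_nonneg, THEN iffD2])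
  moreover have "fps_X ^ nat (?e (int n)) = qpow 1 ^ (n * (n + 1) div 2)" for n
  proof -
    have "?e (int n) = int (2 * (n * (n + 1) div 2))" by (simp add: power2_eq_square algebra_simps)
    then show ?thesis by (simp only: nat_int qpow_def power_mult) simp
  qed
  ultimately have "(\<lambda>n. qpow 1 ^ (n * (n + 1) div 2)) sums ?T"
    by (intro has_sum_imp_sums) simp
  then have triangle: "triangle_series (qpow 1) = ?T"
    unfolding triangle_series_def by (rule sums_unique[symmetric])
  have "theta_pronics 1 = qsum ({0..} \<union> {..<0}) ?e (\<lambda>_. 1)"
    unfolding theta_pronics_def by (rule arg_cong3[where f = qsum]) auto
  also have "\<dots> = ?T + qsum {..<0} ?e (\<lambda>_. 1)"
    by (rule qsum_Un_disjoint[OF nonneg_finite_fibres_pronic]) auto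
  also have "qsum {..<0} ?e (\<lambda>_. 1) = ?T"
    by (rule qsum_reindex[where f = "\<lambda>k. - 1 - k"],
        rule bij_betw_byWitness[where f' = "\<lambda>k. - 1 - k"])
      (auto simp: power2_eq_square algebra_simps)
  finally show ?thesis by (simp add: triangle)
qed

definition theta_even :: "(int \<Rightarrow> 'a::comm_ring_1) \<Rightarrow> 'a fps" where
  "theta_even w = qsum {k. even k} (\<lambda>k. k\<^sup>2) w"

definition theta_odd :: "(int \<Rightarrow> 'a::comm_ring_1) \<Rightarrow> 'a fps" where
  "theta_odd w = qsum {k. odd k} (\<lambda>k. k\<^sup>2) w"

lemma theta_even_1: "theta_even (\<lambda>_. 1) = theta_squares 4"
  unfolding theta_even_def theta_squares_def
proof (rule qsum_reindex[symmetric])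
  show "bij_betw (\<lambda>k. 2 * k) UNIV {k :: int. even k}"
    by (rule bij_betw_byWitness[where f' = "\<lambda>k. k div 2"]) auto
qed auto

lemma theta_odd_1: "theta_odd (\<lambda>_. 1) = fps_X * theta_pronics 4"
proof -
  have "theta_odd (\<lambda>_. 1) = qsum UNIV (\<lambda>k. int 1 + 4 * (k\<^sup>2 + k)) (\<lambda>_. 1 :: real)"
    unfolding theta_odd_def
  proof (rule qsum_reindex[symmetric])
    show "bij_betw (\<lambda>k. 2 * k + 1) UNIV {k :: int. odd k}"
      by (rule bij_betw_byWitness[where f' = "\<lambda>k. k div 2"]) auto
  qed (auto simp: power2_eq_square algebra_simps)
  also have "\<dots> = fps_X ^ 1 * theta_pronics 4"
    unfolding theta_pronics_def of_nat_numeral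
    by (rule fps_X_power_mult_qsum[symmetric]) (rule nonneg_finite_fibres_theta, simp)
  finally show ?thesis by simp
qed

section \<open>The Wronskian of the theta constants\<close>

definition XD_wronskian :: "'a::comm_ring_1 fps \<Rightarrow> 'a fps \<Rightarrow> 'a fps" where
  "XD_wronskian f g = f * fps_XD g - g * fps_XD f"

lemma fps_XD_mult: "fps_XD (f * g) = fps_XD f * g + f * fps_XD (g :: 'a::comm_ring_1 fps)"
  by (simp add: fps_XD_def algebra_simps)

lemma fps_XD_compose_X_power:
  fixes f :: "'a::comm_ring_1 fps"
  shows "fps_XD (f oo fps_X ^ c) = of_nat c * (fps_XD f oo fps_X ^ c)"
proof (rule fps_ext)
  fix n
  have "fps_XD (f oo fps_X ^ c) $ n = of_nat c * (fps_XD f oo fps_X ^ c) $ n"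
    by (auto simp: fps_nth_compose_X_power)
  then show "fps_XD (f oo fps_X ^ c) $ n = (of_nat c * (fps_XD f oo fps_X ^ c)) $ n"
    by (simp flip: fps_of_nat)
qed

lemma XD_wronskian_compose_X_power:
  fixes f g :: "'a::idom fps"
  assumes "c > 0"
  shows "XD_wronskian (f oo fps_X ^ c) (g oo fps_X ^ c) =
    of_nat c * (XD_wronskian f g oo fps_X ^ c)"
  using assms unfolding XD_wronskian_def fps_XD_compose_X_power
  by (simp add: fps_compose_sub_distrib fps_compose_mult_distrib algebra_simps)

lemma XD_wronskian_agm_step:
  fixes f g f' g' :: "'a::{idom, semiring_char_0} fps"
  assumes f: "f\<^sup>2 = f'\<^sup>2 + g'\<^sup>2" and g: "g\<^sup>2 = 2 * f' * g'"
  shows "f * g * XD_wronskian f g = (f'\<^sup>2 - g'\<^sup>2) * XD_wronskian f' g'"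
proof -
  have XD_square: "fps_XD (h\<^sup>2) = 2 * (h * fps_XD h)" for h :: "'a fps"
    by (simp add: power2_eq_square fps_XD_mult)
  have "2 * (f * fps_XD f) = 2 * (f' * fps_XD f' + g' * fps_XD g')"
    using arg_cong[OF f, of fps_XD] by (simp add: XD_square distrib_left)
  then have f_XD: "f * fps_XD f = f' * fps_XD f' + g' * fps_XD g'"
    unfolding mult_cancel_left by simp
  have "fps_XD (g\<^sup>2) = 2 * fps_XD (f' * g')"
    by (simp add: g mult.assoc fps_numeral_fps_const)
  then have "2 * (g * fps_XD g) = 2 * (f' * fps_XD g' + g' * fps_XD f')"
    by (simp add: XD_square fps_XD_mult algebra_simps)
  then have g_XD: "g * fps_XD g = f' * fps_XD g' + g' * fps_XD f'"
    unfolding mult_cancel_left by simp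
  have "f * g * XD_wronskian f g = f\<^sup>2 * (g * fps_XD g) - g\<^sup>2 * (f * fps_XD f)"
    by (simp add: XD_wronskian_def power2_eq_square algebra_simps)
  also have "\<dots> = (f'\<^sup>2 - g'\<^sup>2) * XD_wronskian f' g'"
    unfolding f g f_XD g_XD XD_wronskian_def by (simp add: power2_eq_square algebra_simps)
  finally show ?thesis .
qed

lemma subdegree_compose_X_power:
  fixes f :: "'a::idom fps"
  assumes "c > 0"
  shows "subdegree (f oo fps_X ^ c) = c * subdegree f"
proof (cases "f = 0")
  case False
  show ?thesis
  proof (rule subdegreeI)
    show "(f oo fps_X ^ c) $ (c * subdegree f) \<noteq> 0"
      using False assms by (simp add: fps_nth_compose_X_power)
    show "(f oo fps_X ^ c) $ k = 0" if "k < c * subdegree f" for k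
      using that assms
      by (auto simp: fps_nth_compose_X_power less_mult_imp_div_less mult.commute
          intro!: nth_less_subdegree_zero)
  qed
qed simp

lemma fps_compose_X_power_recursion_eq_0:
  fixes f p s :: "'a::idom fps"
  assumes rec: "p * f = s * (f oo fps_X ^ c)" and c: "c > 1"
    and p: "p $ N \<noteq> 0" and f: "\<And>n. n \<le> N \<Longrightarrow> f $ n = 0"
  shows "f = 0"
proof (rule ccontr)
  assume "f \<noteq> 0"
  moreover have "p \<noteq> 0" using p by auto
  ultimately have "s * (f oo fps_X ^ c) \<noteq> 0" by (simp flip: rec)
  then have "subdegree p + subdegree f = subdegree s + c * subdegree f"
    using arg_cong[OF rec, of subdegree] c \<open>f \<noteq> 0\<close> \<open>p \<noteq> 0\<close>
    by (simp add: subdegree_compose_X_power)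
  moreover have "2 * subdegree f \<le> c * subdegree f" using c by simp
  moreover have "subdegree p \<le> N" using p by (rule subdegree_leI)
  moreover have "N < subdegree f"
    using f \<open>f \<noteq> 0\<close> by (metis linorder_not_le nth_subdegree_nonzero)
  ultimately show False by linarith
qed

context
  fixes \<alpha> \<beta> :: "real fps"
  defines "\<alpha> \<equiv> theta_even (\<lambda>_. 1)" and "\<beta> \<equiv> theta_odd (\<lambda>_. 1)"
begin

lemma theta_even_odd_agm:
  "\<alpha>\<^sup>2 = (\<alpha> oo fps_X\<^sup>2)\<^sup>2 + (\<beta> oo fps_X\<^sup>2)\<^sup>2"
  "\<beta>\<^sup>2 = 2 * (\<alpha> oo fps_X\<^sup>2) * (\<beta> oo fps_X\<^sup>2)"
proof -
  have \<alpha>: "\<alpha> oo fps_X\<^sup>2 = theta_squares 8"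
    by (simp add: \<alpha>_def theta_even_1 theta_squares_compose_X_power)
  have \<beta>: "\<beta> oo fps_X\<^sup>2 = fps_X\<^sup>2 * theta_pronics 8"
    by (simp add: \<beta>_def theta_odd_1 fps_compose_mult_distrib theta_pronics_compose_X_power)
  show "\<alpha>\<^sup>2 = (\<alpha> oo fps_X\<^sup>2)\<^sup>2 + (\<beta> oo fps_X\<^sup>2)\<^sup>2"
    using theta_squares_power2[of 4]
    by (simp add: \<alpha> \<beta>) (simp add: \<alpha>_def theta_even_1 power_mult_distrib flip: power_mult)
  show "\<beta>\<^sup>2 = 2 * (\<alpha> oo fps_X\<^sup>2) * (\<beta> oo fps_X\<^sup>2)"
    using theta_pronics_power2[of 4]
    by (simp add: \<alpha> \<beta>) (simp add: \<beta>_def theta_odd_1 power_mult_distrib mult_ac)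
qed

lemma triangle_series_power4:
  "2 * (fps_X * triangle_series (qpow 1) ^ 4) = \<alpha> * \<beta> * (\<alpha>\<^sup>2 + \<beta>\<^sup>2)"
proof -
  have "8 * (2 * (fps_X * triangle_series (qpow 1) ^ 4)) = fps_X * ((theta_pronics 1)\<^sup>2)\<^sup>2"
    unfolding theta_pronics_eq_triangle_series
    by (simp add: power_mult_distrib flip: power_mult)
  also have "\<dots> = 4 * fps_X * ((theta_pronics 2)\<^sup>2 * (theta_squares 2)\<^sup>2)"
    using theta_pronics_power2[of 1] by (simp add: power_mult_distrib mult_ac)
  also have "\<dots> = 8 * (\<alpha> * \<beta> * (\<alpha>\<^sup>2 + \<beta>\<^sup>2))"
    using theta_pronics_power2[of 2] theta_squares_power2[of 2]
    by (simp add: \<alpha>_def \<beta>_def theta_even_1 theta_odd_1 power_mult_distrib mult_ac)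
  finally show ?thesis unfolding mult_cancel_left by simp
qed

lemma theta_wronskian_recursion:
  fixes r :: "real fps"
  assumes r: "2 * r * (\<alpha>\<^sup>2 - \<beta>\<^sup>2) = XD_wronskian \<alpha> \<beta>"
  shows "\<alpha> * \<beta> * r = 2 * (\<alpha>\<^sup>2 + \<beta>\<^sup>2) * (r oo fps_X\<^sup>2)"
proof -
  define \<alpha>' \<beta>' where "\<alpha>' = \<alpha> oo fps_X\<^sup>2" and "\<beta>' = \<beta> oo fps_X\<^sup>2"
  have agm: "\<alpha>\<^sup>2 = \<alpha>'\<^sup>2 + \<beta>'\<^sup>2" "\<beta>\<^sup>2 = 2 * \<alpha>' * \<beta>'"
    using theta_even_odd_agm by (simp_all add: \<alpha>'_def \<beta>'_def)
  then have squares: "\<alpha>\<^sup>2 - \<beta>\<^sup>2 = (\<alpha>' - \<beta>')\<^sup>2" "\<alpha>\<^sup>2 + \<beta>\<^sup>2 = (\<alpha>' + \<beta>')\<^sup>2"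
    by (simp_all add: power2_sum power2_diff)
  have "XD_wronskian \<alpha>' \<beta>' = 2 * ((2 * r * (\<alpha>\<^sup>2 - \<beta>\<^sup>2)) oo fps_X\<^sup>2)"
    unfolding r \<alpha>'_def \<beta>'_def by (simp add: XD_wronskian_compose_X_power)
  also have "(2 * r * (\<alpha>\<^sup>2 - \<beta>\<^sup>2)) oo fps_X\<^sup>2 = 2 * (r oo fps_X\<^sup>2) * (\<alpha>'\<^sup>2 - \<beta>'\<^sup>2)"
    by (simp add: \<alpha>'_def \<beta>'_def power2_eq_square[of \<alpha>] power2_eq_square[of \<beta>]
        power2_eq_square[of "_ oo _"] fps_compose_mult_distrib fps_compose_sub_distrib
        fps_numeral_fps_const)
  finally have wronskian: "XD_wronskian \<alpha>' \<beta>' = 4 * (r oo fps_X\<^sup>2) * (\<alpha>'\<^sup>2 - \<beta>'\<^sup>2)"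
    by simp
  have "2 * (\<alpha>' - \<beta>')\<^sup>2 * (\<alpha> * \<beta> * r) = \<alpha> * \<beta> * XD_wronskian \<alpha> \<beta>"
    by (simp add: r[symmetric] squares mult_ac)
  also have "\<dots> = (\<alpha>'\<^sup>2 - \<beta>'\<^sup>2) * XD_wronskian \<alpha>' \<beta>'"
    by (rule XD_wronskian_agm_step[OF agm])
  also have "\<dots> = 2 * (\<alpha>' - \<beta>')\<^sup>2 * (2 * (\<alpha>\<^sup>2 + \<beta>\<^sup>2) * (r oo fps_X\<^sup>2))"
    unfolding wronskian squares by (simp add: power2_eq_square algebra_simps)
  finally have "2 * (\<alpha>' - \<beta>')\<^sup>2 * (\<alpha> * \<beta> * r) =
      2 * (\<alpha>' - \<beta>')\<^sup>2 * (2 * (\<alpha>\<^sup>2 + \<beta>\<^sup>2) * (r oo fps_X\<^sup>2))" .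
  moreover have "(\<alpha>' - \<beta>') $ 0 = 1"
    by (simp add: \<alpha>'_def \<beta>'_def \<alpha>_def \<beta>_def theta_even_1 theta_odd_1 theta_squares_nth_0)
  then have "\<alpha>' - \<beta>' \<noteq> 0" by auto
  ultimately show ?thesis by simp
qed

lemma triangle_series_recursion:
  fixes \<tau> :: "real fps"
  defines "\<tau> \<equiv> fps_X * triangle_series (qpow 1) ^ 4"
  shows "\<alpha> * \<beta> * \<tau> = 2 * (\<alpha>\<^sup>2 + \<beta>\<^sup>2) * (\<tau> oo fps_X\<^sup>2)"
proof -
  define \<alpha>' \<beta>' where "\<alpha>' = \<alpha> oo fps_X\<^sup>2" and "\<beta>' = \<beta> oo fps_X\<^sup>2"
  have agm: "\<alpha>\<^sup>2 = \<alpha>'\<^sup>2 + \<beta>'\<^sup>2" "\<beta>\<^sup>2 = 2 * \<alpha>' * \<beta>'"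
    using theta_even_odd_agm by (simp_all add: \<alpha>'_def \<beta>'_def)
  have \<tau>: "2 * \<tau> = \<alpha> * \<beta> * (\<alpha>\<^sup>2 + \<beta>\<^sup>2)"
    unfolding \<tau>_def by (rule triangle_series_power4)
  have "2 * (\<tau> oo fps_X\<^sup>2) = (2 * \<tau>) oo fps_X\<^sup>2"
    by (simp add: fps_compose_mult_distrib fps_numeral_fps_const)
  also have "\<dots> = \<alpha>' * \<beta>' * (\<alpha>'\<^sup>2 + \<beta>'\<^sup>2)"
    unfolding \<tau> by (simp add: \<alpha>'_def \<beta>'_def power2_eq_square[of \<alpha>] power2_eq_square[of \<beta>]
        power2_eq_square[of "_ oo _"] fps_compose_mult_distrib fps_compose_add_distrib)
  finally have quadruple: "2 * (2 * (\<tau> oo fps_X\<^sup>2)) = \<alpha>\<^sup>2 * \<beta>\<^sup>2" by (simp add: agm mult_ac)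
  have "2 * (2 * (\<alpha>\<^sup>2 + \<beta>\<^sup>2) * (\<tau> oo fps_X\<^sup>2)) = (\<alpha>\<^sup>2 + \<beta>\<^sup>2) * (2 * (2 * (\<tau> oo fps_X\<^sup>2)))"
    by (simp only: mult_ac)
  also have "\<dots> = 2 * (\<alpha> * \<beta> * \<tau>)"
    using \<tau> unfolding quadruple by (simp add: power2_eq_square mult_ac)
  finally show ?thesis unfolding mult_cancel_left by simp
qed

text \<open>
  Both sides satisfy the same recursion under \<open>t \<mapsto> t\<^sup>2\<close>, which comes from the step of the
  arithmetic-geometric mean on the theta constants.
\<close>

lemma theta_wronskian_quotient:
  fixes r :: "real fps"
  assumes r: "2 * r * (\<alpha>\<^sup>2 - \<beta>\<^sup>2) = XD_wronskian \<alpha> \<beta>" and r_nth: "r $ 0 = 0" "r $ 1 = 1"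
  shows "r = fps_X * triangle_series (qpow 1) ^ 4"
proof -
  define \<tau> where "\<tau> = fps_X * triangle_series (qpow 1) ^ 4"
  have "triangle_series (qpow 1) $ 0 = 1"
    using theta_pronics_nth_0[of 1] unfolding theta_pronics_eq_triangle_series
    by (simp add: fps_numeral_fps_const)
  then have \<tau>_nth: "\<tau> $ 0 = 0" "\<tau> $ 1 = 1" by (simp_all add: \<tau>_def fps_power_zeroth)
  have "r - \<tau> = 0"
  proof (rule fps_compose_X_power_recursion_eq_0)
    show "\<alpha> * \<beta> * (r - \<tau>) = 2 * (\<alpha>\<^sup>2 + \<beta>\<^sup>2) * ((r - \<tau>) oo fps_X ^ 2)"
      using theta_wronskian_recursion[OF r] triangle_series_recursion
      by (simp add: \<tau>_def right_diff_distrib fps_compose_sub_distrib)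
    show "(\<alpha> * \<beta>) $ 1 \<noteq> 0"
      by (simp add: \<alpha>_def \<beta>_def theta_even_1 theta_odd_1 fps_mult_nth
          theta_squares_nth_0 theta_pronics_nth_0)
    show "(r - \<tau>) $ n = 0" if "n \<le> 1" for n
      using that r_nth \<tau>_nth by (cases n) auto
  qed simp
  then show ?thesis by (simp add: \<tau>_def)
qed

end

section \<open>Kronecker's identity\<close>

definition parity_sign :: "int \<Rightarrow> 'a::comm_ring_1" where
  "parity_sign k = (if even k then 1 else - 1)"

definition same_sign :: "(int \<times> int) set" where
  "same_sign = {(a, b). (0 \<le> a \<and> 0 \<le> b) \<or> (a < 0 \<and> b < 0)}"

text \<open>
  With \<open>x = a + 1/2\<close> and \<open>y = b + 1/2\<close> this is \<open>1\<close> if \<open>x, y > 0\<close>, \<open>-1\<close> if \<open>x, y < 0\<close>, and \<open>0\<close>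
  otherwise.  Written as a difference of two half-plane indicators, it lets each half plane cancel
  separately.
\<close>

definition cross_sgn :: "int \<times> int \<Rightarrow> 'a::comm_ring_1" where
  "cross_sgn = (\<lambda>(a, b). of_bool (0 \<le> b) - of_bool (a < 0))"

definition odd_prod :: "int \<times> int \<Rightarrow> int" where
  "odd_prod = (\<lambda>(a, b). (2 * a + 1) * (2 * b + 1))"

definition two_squares :: "int \<times> int \<Rightarrow> int" where
  "two_squares = (\<lambda>(m, n). 2 * m\<^sup>2 + 2 * n\<^sup>2)"

definition kronecker :: "(int \<Rightarrow> 'a) \<Rightarrow> (int \<Rightarrow> 'a) \<Rightarrow> 'a::comm_ring_1 fps" where
  "kronecker \<chi> \<psi> =
    qsum same_sign odd_prod (\<lambda>(a, b). cross_sgn (a, b) * \<chi> (a - b) * \<psi> (a + b + 1))"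

definition quad_exp :: "(int \<times> int) \<times> (int \<times> int) \<Rightarrow> int" where
  "quad_exp = (\<lambda>(x, y). odd_prod x + two_squares y)"

definition quad_diff :: "(int \<times> int) \<times> (int \<times> int) \<Rightarrow> int" where
  "quad_diff = (\<lambda>((a, b), (m, n)). (a - b) + (m - n))"

definition quad_sum :: "(int \<times> int) \<times> (int \<times> int) \<Rightarrow> int" where
  "quad_sum = (\<lambda>((a, b), (m, n)). (a + b + 1) + (m + n))"

definition quad_sign :: "(int \<times> int) \<times> (int \<times> int) \<Rightarrow> 'a::comm_ring_1" where
  "quad_sign = (\<lambda>(x, (m, n)). parity_sign (m + n))"

definition quad_weight :: "(int \<Rightarrow> int \<Rightarrow> 'a) \<Rightarrow> (int \<times> int) \<times> (int \<times> int) \<Rightarrow> 'a::comm_ring_1" where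
  "quad_weight g z = cross_sgn (fst z) * (quad_sign z * g (quad_diff z) (quad_sum z))"

lemmas quad_simps = quad_exp_def quad_diff_def quad_sum_def quad_sign_def parity_sign_def
  odd_prod_def two_squares_def

lemma add_le_double_mult_int:
  fixes p q :: int
  assumes "1 \<le> p" "1 \<le> q"
  shows "p + q \<le> 2 * (p * q)"
proof -
  have "p * 1 \<le> p * q" "1 * q \<le> p * q"
    using assms by (intro mult_left_mono mult_right_mono; simp)+
  then show ?thesis by simp
qed

lemma nonneg_finite_fibres_odd_prod: "nonneg_finite_fibres same_sign odd_prod"
proof (rule nonneg_finite_fibres_bound[OF
      nonneg_finite_fibres_Times[OF nonneg_finite_fibres_abs nonneg_finite_fibres_abs],
      where f = "\<lambda>(a, b). (2 * a + 1, 2 * b + 1)" and c = 2 and d = 0])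
  fix z assume z: "z \<in> same_sign"
  obtain a b where ab: "z = (a, b)" by (cases z)
  have abs: "odd_prod z = \<bar>2 * a + 1\<bar> * \<bar>2 * b + 1\<bar>"
    using z mult_neg_neg[of "2 * a + 1" "2 * b + 1"]
    by (auto simp: ab odd_prod_def same_sign_def simp flip: abs_mult)
  then show "0 \<le> odd_prod z" by simp
  have "1 \<le> \<bar>2 * k + 1\<bar>" for k :: int by presburger
  then show "(case (case z of (a, b) \<Rightarrow> (2 * a + 1, 2 * b + 1)) of (p, q) \<Rightarrow> \<bar>p\<bar> + \<bar>q\<bar>)
      \<le> 2 * odd_prod z + 0"
    unfolding abs unfolding ab prod.case by (simp only: add_le_double_mult_int add_0_right)
qed (auto simp: inj_on_def)

lemma nonneg_finite_fibres_two_squares: "nonneg_finite_fibres UNIV two_squares"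
  using nonneg_finite_fibres_Times[OF nonneg_finite_fibres_theta(1)[of 2]
      nonneg_finite_fibres_theta(1)[of 2]]
  by (simp add: two_squares_def case_prod_unfold)

lemma nonneg_finite_fibres_quad: "nonneg_finite_fibres (same_sign \<times> UNIV) quad_exp"
  using nonneg_finite_fibres_Times[OF nonneg_finite_fibres_odd_prod
      nonneg_finite_fibres_two_squares]
  by (simp add: quad_exp_def)

lemma double_quad_exp:
  "2 * quad_exp ((a, b), (m, n)) = 4 * ((2 * b + 1) * quad_diff ((a, b), (m, n))) +
    ((2 * b + 1 - 2 * m)\<^sup>2 + (2 * b + 1 + 2 * n)\<^sup>2)"
  by (simp add: quad_simps power2_eq_square algebra_simps)

lemma nonneg_finite_fibres_upper:
  "nonneg_finite_fibres {z. 0 \<le> snd (fst z) \<and> 0 < quad_diff z} quad_exp"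
    (is "nonneg_finite_fibres ?I _")
proof -
  let ?e = "\<lambda>((p, q), (r, s)). (\<bar>p\<bar> + \<bar>q\<bar>) + (r\<^sup>2 + s\<^sup>2) :: int"
  let ?f = "\<lambda>((a, b), (m, n)). ((2 * b + 1, quad_diff ((a, b), (m, n))),
      (2 * b + 1 - 2 * m, 2 * b + 1 + 2 * n))"
  have "nonneg_finite_fibres UNIV ?e"
    using nonneg_finite_fibres_Times[OF
        nonneg_finite_fibres_Times[OF nonneg_finite_fibres_abs nonneg_finite_fibres_abs]
        nonneg_finite_fibres_Times[OF nonneg_finite_fibres_square[of UNIV]
          nonneg_finite_fibres_square[of UNIV]]]
    by (simp add: case_prod_unfold)
  then show ?thesis
  proof (rule nonneg_finite_fibres_bound[where f = ?f and c = 2 and d = 0])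
    fix z assume z: "z \<in> ?I"
    obtain a b m n where ab: "z = ((a, b), (m, n))" by (metis surj_pair)
    have "1 \<le> 2 * b + 1" "1 \<le> quad_diff z" using z ab by auto
    then have "(2 * b + 1) + quad_diff z \<le> 2 * ((2 * b + 1) * quad_diff z)"
      by (rule add_le_double_mult_int)
    with double_quad_exp[of a b m n] z show "?e (?f z) \<le> 2 * quad_exp z + 0" by (simp add: ab)
    moreover have "0 \<le> ?e (?f z)" by (simp add: ab)
    ultimately show "0 \<le> quad_exp z" by linarith
  qed (auto simp: inj_on_def quad_diff_def)
qed

lemma nonneg_finite_fibres_left:
  "nonneg_finite_fibres {z. fst (fst z) < 0 \<and> 0 < quad_diff z} quad_exp"
proof -
  let ?f = "\<lambda>((a, b), (m, n)). ((-1 - b, -1 - a), (- n, - m)) :: (int \<times> int) \<times> (int \<times> int)"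
  have maps_to: "?f z \<in> {z. 0 \<le> snd (fst z) \<and> 0 < quad_diff z}"
    if "z \<in> {z. fst (fst z) < 0 \<and> 0 < quad_diff z}" for z
    using that by (auto simp: quad_diff_def split: prod.splits)
  have quad_exp: "quad_exp (?f z) = quad_exp z" for z
    by (auto simp: quad_simps algebra_simps split: prod.splits)
  show ?thesis
  proof (rule nonneg_finite_fibres_bound[OF nonneg_finite_fibres_upper _ maps_to,
        where c = 1 and d = 0])
    show "0 \<le> quad_exp z" if "z \<in> {z. fst (fst z) < 0 \<and> 0 < quad_diff z}" for z
      using exponent_nonneg[OF nonneg_finite_fibres_upper maps_to[OF that]] by (simp only: quad_exp)
  qed (auto simp: inj_on_def quad_exp)
qed

text \<open>
  On the half plane \<open>y > 0\<close> reflect \<open>x\<close> with \<open>y\<close>, \<open>x + m\<close> and \<open>n\<close> fixed; this preserves the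
  exponent and changes the parity of \<open>m\<close>.  On \<open>x < 0\<close> the roles of the coordinates are exchanged.
  The condition on \<open>quad_diff\<close> makes the fibres over the half planes finite.
\<close>

lemma qsum_quad_diff_pos:
  fixes g :: "int \<Rightarrow> int \<Rightarrow> 'a::{idom, semiring_char_0}"
  shows "qsum {z \<in> same_sign \<times> UNIV. 0 < quad_diff z} quad_exp (quad_weight g) = 0"
proof -
  let ?upper = "{z. 0 \<le> snd (fst z) \<and> 0 < quad_diff z}"
  let ?left = "{z. fst (fst z) < 0 \<and> 0 < quad_diff z}"
  let ?w = "\<lambda>z. quad_sign z * g (quad_diff z) (quad_sum z)"
  have weight: "quad_weight g =
      (\<lambda>z. of_bool (0 \<le> snd (fst z)) * ?w z - of_bool (fst (fst z) < 0) * ?w z)"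
    by (auto simp: fun_eq_iff quad_weight_def cross_sgn_def)
  have fin: "nonneg_finite_fibres (?upper \<union> ?left) quad_exp"
    by (rule nonneg_finite_fibres_Un[OF nonneg_finite_fibres_upper nonneg_finite_fibres_left])
  have upper: "qsum ?upper quad_exp ?w = 0"
    by (rule qsum_involution_eq_0[where f = "\<lambda>((a, b), (m, n)).
          ((a + 2 * m - 2 * b - 1, b), (2 * b + 1 - m, n))"])
      (auto simp: quad_simps power2_eq_square algebra_simps)
  have left: "qsum ?left quad_exp ?w = 0"
    by (rule qsum_involution_eq_0[where f = "\<lambda>((a, b), (m, n)).
          ((a, b + 2 * n - 2 * a - 1), (m, 2 * a + 1 - n))"])
      (auto simp: quad_simps power2_eq_square algebra_simps)
  have "qsum {z \<in> same_sign \<times> UNIV. 0 < quad_diff z} quad_exp (quad_weight g) =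
      qsum (?upper \<union> ?left) quad_exp (quad_weight g)"
    by (rule qsum_mono_neutral[OF fin, symmetric])
      (auto simp: same_sign_def quad_weight_def cross_sgn_def split: if_splits)
  also have "\<dots> = qsum {z \<in> ?upper \<union> ?left. 0 \<le> snd (fst z)} quad_exp ?w -
      qsum {z \<in> ?upper \<union> ?left. fst (fst z) < 0} quad_exp ?w"
    unfolding weight by (simp only: qsum_diff qsum_of_bool[OF fin])
  also have "{z \<in> ?upper \<union> ?left. 0 \<le> snd (fst z)} = ?upper" by auto
  also have "{z \<in> ?upper \<union> ?left. fst (fst z) < 0} = ?left" by auto
  finally show ?thesis unfolding upper left by simp
qed

lemma qsum_quad_diff_neg:
  fixes g :: "int \<Rightarrow> int \<Rightarrow> 'a::{idom, semiring_char_0}"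
  shows "qsum {z \<in> same_sign \<times> UNIV. quad_diff z < 0} quad_exp (quad_weight g) = 0"
proof -
  let ?swap = "\<lambda>((a, b), (m, n)). ((b, a), (n, m)) :: (int \<times> int) \<times> (int \<times> int)"
  have "qsum {z \<in> same_sign \<times> UNIV. quad_diff z < 0} quad_exp (quad_weight g) =
      qsum {z \<in> same_sign \<times> UNIV. 0 < quad_diff z} quad_exp (quad_weight (\<lambda>p. g (- p)))"
  proof (rule qsum_reindex)
    show "bij_betw ?swap {z \<in> same_sign \<times> UNIV. quad_diff z < 0}
        {z \<in> same_sign \<times> UNIV. 0 < quad_diff z}"
      by (rule bij_betw_byWitness[where f' = ?swap]) (auto simp: same_sign_def quad_diff_def)
    show "quad_exp (?swap z) = quad_exp z" for z
      by (auto simp: quad_simps split: prod.splits)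
    show "quad_weight (\<lambda>p. g (- p)) (?swap z) = quad_weight g z"
      if "z \<in> {z \<in> same_sign \<times> UNIV. quad_diff z < 0}" for z
      using that
      by (auto simp: quad_weight_def same_sign_def cross_sgn_def quad_simps algebra_simps)
  qed
  then show ?thesis by (simp add: qsum_quad_diff_pos)
qed

lemma qsum_quad_weight:
  fixes g :: "int \<Rightarrow> int \<Rightarrow> 'a::{idom, semiring_char_0}"
  shows "qsum (same_sign \<times> UNIV) quad_exp (quad_weight g) =
    qsum {z \<in> same_sign \<times> UNIV. quad_diff z = 0} quad_exp (quad_weight g)"
proof -
  let ?on = "\<lambda>P. {z \<in> same_sign \<times> (UNIV :: (int \<times> int) set). P (quad_diff z)}"
  let ?pos = "?on (\<lambda>d. 0 < d)" and ?neg = "?on (\<lambda>d. d < 0)" and ?zero = "?on (\<lambda>d. d = 0)"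
  have fin: "nonneg_finite_fibres I quad_exp" if "I \<subseteq> same_sign \<times> UNIV" for I
    by (rule nonneg_finite_fibres_subset[OF nonneg_finite_fibres_quad that])
  have "same_sign \<times> UNIV = ?zero \<union> (?pos \<union> ?neg)" by auto
  then have "qsum (same_sign \<times> UNIV) quad_exp (quad_weight g) =
      qsum (?zero \<union> (?pos \<union> ?neg)) quad_exp (quad_weight g)"
    by (rule arg_cong)
  also have "\<dots> = qsum ?zero quad_exp (quad_weight g) +
      qsum (?pos \<union> ?neg) quad_exp (quad_weight g)"
    by (rule qsum_Un_disjoint, rule fin) auto
  also have "qsum (?pos \<union> ?neg) quad_exp (quad_weight g) =
      qsum ?pos quad_exp (quad_weight g) + qsum ?neg quad_exp (quad_weight g)"
    by (rule qsum_Un_disjoint, rule fin) auto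
  finally show ?thesis by (simp add: qsum_quad_diff_pos qsum_quad_diff_neg)
qed

lemma sum_cross_sgn_fibre:
  assumes "odd (N + K)"
  shows "(\<Sum>z | z \<in> {z \<in> same_sign \<times> UNIV. quad_diff z = 0} \<and>
      (\<lambda>((a, b), (m, n)). (a + b + 1, m + n)) z = (N, K). cross_sgn (fst z)) = of_int N"
    (is "sum _ ?F = _")
proof -
  let ?point = "\<lambda>a. ((a, N - 1 - a), ((K + N - 1 - 2 * a) div 2, (K - N + 1 + 2 * a) div 2))"
  define A where "A = (if N > 0 then {0..<N} else {N..<0})"
  have half: "(K + N - 1 - 2 * a) div 2 + (K - N + 1 + 2 * a) div 2 = K"
    "(K + N - 1 - 2 * a) div 2 - (K - N + 1 + 2 * a) div 2 = N - 1 - 2 * a" for a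
    using assms by presburger+
  have bij: "bij_betw ?point A ?F"
  proof (rule bij_betw_byWitness[where f' = "\<lambda>z. fst (fst z)"])
    show "\<forall>a\<in>A. fst (fst (?point a)) = a" by simp
    show "\<forall>z\<in>?F. ?point (fst (fst z)) = z" by (auto simp: quad_diff_def)
    show "?point ` A \<subseteq> ?F"
      using half by (auto simp: A_def same_sign_def quad_diff_def split: if_splits)
    show "(\<lambda>z. fst (fst z)) ` ?F \<subseteq> A" by (auto simp: A_def same_sign_def)
  qed
  have "sum (\<lambda>z. cross_sgn (fst z)) ?F = (\<Sum>a\<in>A. cross_sgn (fst (?point a)))"
    by (rule sum.reindex_bij_betw[OF bij, symmetric])
  also have "\<dots> = (\<Sum>a\<in>A. if N > 0 then 1 else - 1)"
    by (rule sum.cong) (auto simp: A_def cross_sgn_def split: if_splits)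
  also have "\<dots> = of_int N" by (simp add: A_def)
  finally show ?thesis .
qed

lemma nonneg_finite_fibres_sum_squares: "nonneg_finite_fibres I (\<lambda>(k, l :: int). k\<^sup>2 + l\<^sup>2)"
  by (rule nonneg_finite_fibres_subset[OF nonneg_finite_fibres_Times
        [OF nonneg_finite_fibres_square nonneg_finite_fibres_square], of _ UNIV UNIV]) auto

lemma qsum_quad_diff_0:
  fixes g :: "int \<Rightarrow> int \<Rightarrow> 'a::comm_ring_1"
  shows "qsum {z \<in> same_sign \<times> UNIV. quad_diff z = 0} quad_exp (quad_weight g) =
    qsum {(N, K). odd (N + K)} (\<lambda>(N, K). N\<^sup>2 + K\<^sup>2)
      (\<lambda>(N, K). of_int N * (parity_sign K * g 0 (N + K)))"
    (is "qsum ?Z _ _ = qsum ?J ?e _")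
proof -
  let ?f = "\<lambda>((a, b), (m, n)). (a + b + 1, m + n) :: int \<times> int"
  have "qsum ?Z quad_exp (quad_weight g) =
      qsum ?J ?e (\<lambda>j. \<Sum>z | z \<in> ?Z \<and> ?f z = j. quad_weight g z)"
  proof (rule qsum_fibres)
    show "nonneg_finite_fibres ?Z quad_exp"
      by (rule nonneg_finite_fibres_subset[OF nonneg_finite_fibres_quad]) auto
    show "?f z \<in> ?J" if "z \<in> ?Z" for z
      using that by (cases z) (auto simp: quad_diff_def; presburger)
    show "?e (?f z) = quad_exp z" if "z \<in> ?Z" for z
    proof -
      obtain a b m n where z: "z = ((a, b), (m, n))" by (metis surj_pair)
      with that have m: "m = n + b - a" by (auto simp: quad_diff_def)
      show ?thesis unfolding z m by (simp add: quad_simps power2_eq_square algebra_simps)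
    qed
  qed (rule nonneg_finite_fibres_sum_squares)
  also have "\<dots> = qsum ?J ?e (\<lambda>(N, K). of_int N * (parity_sign K * g 0 (N + K)))"
  proof (rule qsum_cong[OF refl], safe)
    fix N K :: int assume odd: "odd (N + K)"
    have "(\<Sum>z | z \<in> ?Z \<and> ?f z = (N, K). quad_weight g z) =
        (\<Sum>z | z \<in> ?Z \<and> ?f z = (N, K). cross_sgn (fst z) * (parity_sign K * g 0 (N + K)))"
      by (rule sum.cong) (auto simp: quad_weight_def quad_sign_def quad_sum_def)
    also have "\<dots> = of_int N * (parity_sign K * g 0 (N + K))"
      unfolding sum_distrib_right[symmetric] sum_cross_sgn_fibre[OF odd] ..
    finally show "(\<Sum>z | z \<in> ?Z \<and> ?f z = (N, K). quad_weight g z) = \<dots>" .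
  qed
  finally show ?thesis .
qed

lemma qsum_squares_mult:
  fixes w :: "int \<Rightarrow> 'a::comm_ring_1"
  shows "qsum I (\<lambda>k. k\<^sup>2) w * qsum J (\<lambda>k. k\<^sup>2) w' =
    qsum (I \<times> J) (\<lambda>(k, l). k\<^sup>2 + l\<^sup>2) (\<lambda>(k, l). w k * w' l)"
  by (rule qsum_mult[OF nonneg_finite_fibres_square nonneg_finite_fibres_square])

lemma theta_product:
  fixes \<chi> \<psi> :: "int \<Rightarrow> 'a::comm_ring_1"
  shows "qsum UNIV two_squares (\<lambda>(m, n). parity_sign (m + n) * \<chi> (m - n) * \<psi> (m + n)) =
    theta_even \<chi> * theta_even \<psi> - theta_odd \<chi> * theta_odd \<psi>"
proof -
  let ?ev = "{k :: int. even k}" and ?od = "{k :: int. odd k}"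
  let ?e = "\<lambda>(k, l :: int). k\<^sup>2 + l\<^sup>2" and ?w = "\<lambda>(k, l). parity_sign k * (\<psi> k * \<chi> l)"
  have split: "{(k, l :: int). even (k + l)} = ?ev \<times> ?ev \<union> ?od \<times> ?od" by auto
  have "qsum UNIV two_squares (\<lambda>(m, n). parity_sign (m + n) * \<chi> (m - n) * \<psi> (m + n)) =
      qsum {(k, l). even (k + l)} ?e ?w"
    by (rule qsum_reindex[OF bij_betw_int_pairs_even])
      (auto simp: two_squares_def power2_eq_square algebra_simps)
  also have "\<dots> = qsum (?ev \<times> ?ev) ?e ?w + qsum (?od \<times> ?od) ?e ?w"
    unfolding split by (rule qsum_Un_disjoint[OF nonneg_finite_fibres_sum_squares]) auto
  also have "qsum (?ev \<times> ?ev) ?e ?w = theta_even \<psi> * theta_even \<chi>"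
    unfolding theta_even_def qsum_squares_mult by (rule qsum_cong) (auto simp: parity_sign_def)
  also have "qsum (?od \<times> ?od) ?e ?w = - (theta_odd \<psi> * theta_odd \<chi>)"
    unfolding theta_odd_def qsum_squares_mult qsum_uminus[symmetric]
    by (rule qsum_cong) (auto simp: parity_sign_def)
  finally show ?thesis by (simp add: mult.commute)
qed

lemma qsum_odd_pairs_eq_theta_wronskian:
  fixes \<psi> :: "int \<Rightarrow> 'a::comm_ring_1"
  assumes \<psi>: "\<And>p q. \<psi> (p + q) = \<psi> p * \<psi> q"
  shows "qsum {(N, K). odd (N + K)} (\<lambda>(N, K). N\<^sup>2 + K\<^sup>2)
      (\<lambda>(N, K). of_int N * (parity_sign K * \<psi> (N + K))) =
    theta_even \<psi> * theta_odd (\<lambda>k. of_int k * \<psi> k) -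
    theta_odd \<psi> * theta_even (\<lambda>k. of_int k * \<psi> k)"
proof -
  let ?ev = "{k :: int. even k}" and ?od = "{k :: int. odd k}"
  let ?e = "\<lambda>(N, K :: int). N\<^sup>2 + K\<^sup>2"
  let ?w = "\<lambda>(N, K). of_int N * (parity_sign K * \<psi> (N + K))"
  have split: "{(N, K :: int). odd (N + K)} = ?od \<times> ?ev \<union> ?ev \<times> ?od" by auto
  have "qsum {(N, K). odd (N + K)} ?e ?w = qsum (?od \<times> ?ev) ?e ?w + qsum (?ev \<times> ?od) ?e ?w"
    unfolding split by (rule qsum_Un_disjoint[OF nonneg_finite_fibres_sum_squares]) auto
  also have "qsum (?od \<times> ?ev) ?e ?w = theta_odd (\<lambda>k. of_int k * \<psi> k) * theta_even \<psi>"
    unfolding theta_even_def theta_odd_def qsum_squares_mult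
    by (rule qsum_cong) (auto simp: parity_sign_def \<psi> mult_ac)
  also have "qsum (?ev \<times> ?od) ?e ?w = - (theta_even (\<lambda>k. of_int k * \<psi> k) * theta_odd \<psi>)"
    unfolding theta_even_def theta_odd_def qsum_squares_mult qsum_uminus[symmetric]
    by (rule qsum_cong) (auto simp: parity_sign_def \<psi> mult_ac)
  finally show ?thesis by (simp add: mult.commute)
qed

theorem kronecker_mult_theta_product:
  fixes \<chi> \<psi> :: "int \<Rightarrow> 'a::{idom, semiring_char_0}"
  assumes \<chi>: "\<And>p q. \<chi> (p + q) = \<chi> p * \<chi> q" "\<chi> 0 = 1"
    and \<psi>: "\<And>p q. \<psi> (p + q) = \<psi> p * \<psi> q"
  shows "kronecker \<chi> \<psi> * (theta_even \<chi> * theta_even \<psi> - theta_odd \<chi> * theta_odd \<psi>) =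
    theta_even \<psi> * theta_odd (\<lambda>k. of_int k * \<psi> k) -
    theta_odd \<psi> * theta_even (\<lambda>k. of_int k * \<psi> k)"
proof -
  have "kronecker \<chi> \<psi> * (theta_even \<chi> * theta_even \<psi> - theta_odd \<chi> * theta_odd \<psi>) =
      qsum (same_sign \<times> UNIV) quad_exp (quad_weight (\<lambda>p q. \<chi> p * \<psi> q))"
    unfolding kronecker_def theta_product[symmetric]
      qsum_mult[OF nonneg_finite_fibres_odd_prod nonneg_finite_fibres_two_squares]
    by (rule qsum_cong)
      (auto simp: quad_weight_def quad_exp_def quad_diff_def quad_sum_def quad_sign_def \<chi> \<psi> mult_ac)
  also have "\<dots> = qsum {(N, K). odd (N + K)} (\<lambda>(N, K). N\<^sup>2 + K\<^sup>2)
      (\<lambda>(N, K). of_int N * (parity_sign K * \<psi> (N + K)))"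
    unfolding qsum_quad_weight qsum_quad_diff_0 \<chi>(2) by simp
  also note qsum_odd_pairs_eq_theta_wronskian[OF \<psi>]
  finally show ?thesis .
qed

section \<open>Taylor coefficients of the Kronecker series\<close>

definition fps_tensor :: "'a fps \<Rightarrow> 'a fps \<Rightarrow> 'a::comm_ring_1 fps fps" where
  "fps_tensor f g = Abs_fps (\<lambda>j. Abs_fps (\<lambda>i. f $ i * g $ j))"

lemma fps_tensor_nth [simp]: "fps_tensor f g $ j $ i = f $ i * g $ j"
  by (simp add: fps_tensor_def)

lemma fps_tensor_1_1 [simp]: "fps_tensor 1 1 = 1"
proof (intro fps_ext)
  fix j i show "fps_tensor 1 1 $ j $ i = (1 :: 'a fps fps) $ j $ i" by (cases j) simp_all
qed

lemma fps_tensor_mult: "fps_tensor f g * fps_tensor f' g' = fps_tensor (f * f') (g * g')"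
proof (intro fps_ext)
  fix j i
  have "(fps_tensor f g * fps_tensor f' g') $ j $ i =
      (\<Sum>a=0..j. \<Sum>b=0..i. (g $ a * g' $ (j - a)) * (f $ b * f' $ (i - b)))"
    by (simp add: fps_mult_nth fps_sum_nth mult_ac)
  also have "\<dots> = (g * g') $ j * (f * f') $ i"
    unfolding fps_mult_nth sum_product ..
  finally show "(fps_tensor f g * fps_tensor f' g') $ j $ i = fps_tensor (f * f') (g * g') $ j $ i"
    by (simp add: mult.commute)
qed

lemma fps_tensor_power: "fps_tensor f g ^ n = fps_tensor (f ^ n) (g ^ n)"
  by (induction n) (simp_all add: fps_tensor_mult)

text \<open>
  So far \<open>t\<close> is the outermost variable.  \<open>fps_rotate\<close> makes it innermost, so that the coefficients of
  \<open>v ^ j\<close> (outermost) and \<open>u ^ i\<close> become series in \<open>t\<close>; with these conventions \<open>fps_tensor f g\<close> is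
  \<open>f(u) g(v)\<close>.
\<close>

definition fps_transpose :: "'a fps fps \<Rightarrow> 'a::zero fps fps" where
  "fps_transpose F = Abs_fps (\<lambda>i. Abs_fps (\<lambda>n. F $ n $ i))"

definition fps_rotate :: "'a fps fps fps \<Rightarrow> 'a::zero fps fps fps" where
  "fps_rotate F = Abs_fps (\<lambda>j. Abs_fps (\<lambda>i. Abs_fps (\<lambda>n. F $ n $ j $ i)))"

lemma fps_rotate_nth [simp]: "fps_rotate F $ j $ i $ n = F $ n $ j $ i"
  by (simp add: fps_rotate_def)

lemma fps_rotate_diff:
  "fps_rotate (F - G) = fps_rotate F - fps_rotate (G :: 'a::comm_ring_1 fps fps fps)"
  by (intro fps_ext) simp

lemma fps_rotate_mult:
  "fps_rotate (F * G) = fps_rotate F * fps_rotate (G :: 'a::comm_ring_1 fps fps fps)"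
proof (intro fps_ext)
  fix j i n
  let ?term = "\<lambda>l a b. F $ l $ a $ b * G $ (n - l) $ (j - a) $ (i - b)"
  have "fps_rotate (F * G) $ j $ i $ n = (\<Sum>l=0..n. \<Sum>a=0..j. \<Sum>b=0..i. ?term l a b)"
    by (simp add: fps_mult_nth fps_sum_nth)
  also have "\<dots> = (\<Sum>a=0..j. \<Sum>l=0..n. \<Sum>b=0..i. ?term l a b)" by (rule sum.swap)
  also have "\<dots> = (\<Sum>a=0..j. \<Sum>b=0..i. \<Sum>l=0..n. ?term l a b)"
    by (intro sum.cong refl sum.swap)
  also have "\<dots> = (fps_rotate F * fps_rotate G) $ j $ i $ n"
    by (simp add: fps_mult_nth fps_sum_nth)
  finally show "fps_rotate (F * G) $ j $ i $ n = \<dots>" .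
qed

lemma fps_rotate_qsum_nth: "fps_rotate (qsum I e w) $ j $ i = qsum I e (\<lambda>x. w x $ j $ i)"
  by (intro fps_ext) (simp add: qsum_nth fps_sum_nth)

lemma fps_transpose_qsum_nth: "fps_transpose (qsum I e w) $ i = qsum I e (\<lambda>x. w x $ i)"
  by (intro fps_ext) (simp add: fps_transpose_def qsum_nth fps_sum_nth)

lemma fps_rotate_qsum_tensor:
  fixes w :: "'i \<Rightarrow> 'a::comm_ring_1 fps"
  shows "fps_rotate (qsum I e (\<lambda>x. fps_tensor (w x) 1)) = fps_tensor (fps_transpose (qsum I e w)) 1"
    and "fps_rotate (qsum I e (\<lambda>x. fps_tensor 1 (w x))) = fps_tensor 1 (fps_transpose (qsum I e w))"
  by (intro fps_ext; simp add: fps_rotate_qsum_nth fps_transpose_qsum_nth)+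

lemma fps_transpose_qsum_deriv:
  fixes w :: "'i \<Rightarrow> 'a::comm_ring_1 fps"
  shows "fps_transpose (qsum I e (\<lambda>x. fps_deriv (w x))) = fps_deriv (fps_transpose (qsum I e w))"
  by (intro fps_ext) (simp add: fps_transpose_qsum_nth qsum_cmult flip: fps_of_nat)

definition exp_theta_even :: "real fps fps" where
  "exp_theta_even = fps_transpose (theta_even (\<lambda>k. fps_exp (of_int k)))"

definition exp_theta_odd :: "real fps fps" where
  "exp_theta_odd = fps_transpose (theta_odd (\<lambda>k. fps_exp (of_int k)))"

definition exp_theta_wronskian :: "real fps fps" where
  "exp_theta_wronskian =
     exp_theta_even * fps_deriv exp_theta_odd - exp_theta_odd * fps_deriv exp_theta_even"

definition kronecker_series :: "real fps fps fps" where
  "kronecker_series = fps_rotate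
     (kronecker (\<lambda>p. fps_tensor (fps_exp (of_int p)) 1) (\<lambda>q. fps_tensor 1 (fps_exp (of_int q))))"

lemma exp_theta_even_nth: "exp_theta_even $ i = theta_even (\<lambda>k. of_int k ^ i / fact i)"
  by (simp add: exp_theta_even_def theta_even_def fps_transpose_qsum_nth)

lemma exp_theta_odd_nth: "exp_theta_odd $ i = theta_odd (\<lambda>k. of_int k ^ i / fact i)"
  by (simp add: exp_theta_odd_def theta_odd_def fps_transpose_qsum_nth)

lemma kronecker_series_nth:
  "kronecker_series $ j $ i = qsum same_sign odd_prod
    (\<lambda>(a, b). cross_sgn (a, b) * (of_int (a - b) ^ i / fact i) * (of_int (a + b + 1) ^ j / fact j))"
  unfolding kronecker_series_def kronecker_def fps_rotate_qsum_nth
  by (rule qsum_cong[OF refl]) (auto simp: same_sign_def cross_sgn_def fps_tensor_mult)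

theorem kronecker_series_mult_theta:
  "kronecker_series *
      (fps_tensor exp_theta_even exp_theta_even - fps_tensor exp_theta_odd exp_theta_odd) =
    fps_tensor 1 exp_theta_wronskian"
proof -
  let ?\<chi> = "\<lambda>p. fps_tensor (fps_exp (real_of_int p)) 1"
    and ?\<psi> = "\<lambda>q. fps_tensor 1 (fps_exp (real_of_int q))"
  have deriv: "of_int k * ?\<psi> k = fps_tensor 1 (fps_deriv (fps_exp (of_int k)))" for k
    by (intro fps_ext) (simp flip: fps_of_int)
  have diff: "fps_tensor 1 (f - g) = fps_tensor 1 f - fps_tensor 1 g" for f g :: "real fps fps"
    by (intro fps_ext) (simp add: algebra_simps)
  have "kronecker ?\<chi> ?\<psi> * (theta_even ?\<chi> * theta_even ?\<psi> - theta_odd ?\<chi> * theta_odd ?\<psi>) =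
      theta_even ?\<psi> * theta_odd (\<lambda>k. of_int k * ?\<psi> k) -
      theta_odd ?\<psi> * theta_even (\<lambda>k. of_int k * ?\<psi> k)"
    by (rule kronecker_mult_theta_product) (simp_all add: fps_exp_add_mult fps_tensor_mult)
  from arg_cong[OF this, of fps_rotate] show ?thesis
    unfolding deriv fps_rotate_mult fps_rotate_diff kronecker_series_def[symmetric]
      theta_even_def theta_odd_def fps_rotate_qsum_tensor fps_transpose_qsum_deriv
    by (simp add: exp_theta_even_def exp_theta_odd_def theta_even_def theta_odd_def
        exp_theta_wronskian_def fps_tensor_mult diff)
qed

section \<open>Determinants\<close>

lemma det_mat_leibniz:
  "det (mat n n f) = (\<Sum>p | p permutes {0..<n}. signof p * (\<Prod>i=0..<n. f (i, p i)))"
  by (subst det_def'[of _ n]) (auto intro!: sum.cong prod.cong arg_cong2[where f = "(*)"])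

lemma det_mat_permute_rows:
  assumes "p permutes {0..<n}"
  shows "det (mat n n (\<lambda>(i, j). M (p i) j)) = signof p * det (mat n n (\<lambda>(i, j). M i j))"
proof -
  have "mat n n (\<lambda>(i, j). M (p i) j) = mat n n (\<lambda>(i, j). mat n n (\<lambda>(i, j). M i j) $$ (p i, j))"
    using permutes_in_image[OF assms] by (intro eq_matI) auto
  also have "det \<dots> = signof p * det (mat n n (\<lambda>(i, j). M i j))"
    by (rule det_permute_rows[OF _ assms]) simp
  finally show ?thesis .
qed

lemma det_scale_rows_cols:
  "det (mat n n (\<lambda>(i, j). r i * c j * M i j)) =
    (\<Prod>i<n. r i) * (\<Prod>j<n. c j) * det (mat n n (\<lambda>(i, j). M i j))"
  unfolding det_mat_leibniz sum_distrib_left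
proof (rule sum.cong[OF refl])
  fix p assume "p \<in> {p. p permutes {0..<n}}"
  then have "(\<Prod>i=0..<n. c (p i)) = (\<Prod>j=0..<n. c j)"
    by (simp add: prod.permute[of p _ c] o_def)
  then show "signof p * (\<Prod>i=0..<n. case (i, p i) of (i, j) \<Rightarrow> r i * c j * M i j) =
      (\<Prod>i<n. r i) * (\<Prod>j<n. c j) * (signof p * (\<Prod>i=0..<n. case (i, p i) of (i, j) \<Rightarrow> M i j))"
    by (simp add: prod.distrib lessThan_atLeast0 mult_ac)
qed

lemma det_lower_upper:
  fixes L U :: "nat \<Rightarrow> nat \<Rightarrow> 'a::comm_ring_1"
  assumes lower: "\<And>i k. i < k \<Longrightarrow> L i k = 0" and upper: "\<And>k j. j < k \<Longrightarrow> U k j = 0"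
  shows "det (mat n n (\<lambda>(i, j). \<Sum>k<n. L i k * U k j)) = (\<Prod>k<n. L k k * U k k)"
proof -
  define L' U' where "L' = mat n n (\<lambda>(i, k). L i k)" and "U' = mat n n (\<lambda>(k, j). U k j)"
  have carrier: "L' \<in> carrier_mat n n" "U' \<in> carrier_mat n n" by (simp_all add: L'_def U'_def)
  have "mat n n (\<lambda>(i, j). \<Sum>k<n. L i k * U k j) = L' * U'"
    by (rule eq_matI) (auto simp: L'_def U'_def scalar_prod_def lessThan_atLeast0)
  then have "det (mat n n (\<lambda>(i, j). \<Sum>k<n. L i k * U k j)) = det L' * det U'"
    by (simp add: det_mult[OF carrier])
  also have "det L' = prod_list (diag_mat L')"
    by (rule det_lower_triangular[OF _ carrier(1)]) (simp add: L'_def lower)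
  also have "det U' = prod_list (diag_mat U')"
    by (rule det_upper_triangular[OF _ carrier(2)]) (auto simp: U'_def upper)
  finally show ?thesis
    by (simp add: prod_list_diag_prod L'_def U'_def lessThan_atLeast0 prod.distrib)
qed

text \<open>The coefficients of \<open>y ^ j\<close> in the Newton basis \<open>\<Prod>l<k. y - x l\<close>.\<close>

fun newton_coeff :: "(nat \<Rightarrow> 'a::comm_ring_1) \<Rightarrow> nat \<Rightarrow> nat \<Rightarrow> 'a" where
  "newton_coeff x k 0 = (if k = 0 then 1 else 0)"
| "newton_coeff x k (Suc j) =
    (if k = 0 then 0 else newton_coeff x (k - 1) j) + x k * newton_coeff x k j"

lemma newton_coeff_eq_0: "j < k \<Longrightarrow> newton_coeff x k j = 0"
  by (induction j arbitrary: k) auto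

lemma newton_coeff_diag: "newton_coeff x k k = 1"
  by (induction k) (auto simp: newton_coeff_eq_0)

lemma power_eq_newton_sum:
  "j < n \<Longrightarrow> y ^ j = (\<Sum>k<n. (\<Prod>l<k. y - x l) * newton_coeff x k j)"
proof (induction j arbitrary: n)
  case 0
  then have "(\<Sum>k<n. (\<Prod>l<k. y - x l) * newton_coeff x k 0) =
      (\<Sum>k\<in>{0}. (\<Prod>l<k. y - x l) * newton_coeff x k 0)"
    by (intro sum.mono_neutral_right) auto
  then show ?case by simp
next
  case (Suc j)
  then obtain n' where n: "n = Suc n'" "j < n'" by (cases n) auto
  let ?p = "\<lambda>k. \<Prod>l<k. y - x l"
  have "(\<Sum>k<n. ?p k * newton_coeff x k (Suc j)) =
      (\<Sum>k<n. ?p k * (if k = 0 then 0 else newton_coeff x (k - 1) j)) +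
      (\<Sum>k<n. ?p k * (x k * newton_coeff x k j))"
    by (simp add: algebra_simps sum.distrib)
  also have "(\<Sum>k<n. ?p k * (if k = 0 then 0 else newton_coeff x (k - 1) j)) =
      (\<Sum>k<n'. ?p (Suc k) * newton_coeff x k j)"
    unfolding n sum.lessThan_Suc_shift by simp
  also have "(\<Sum>k<n. ?p k * (x k * newton_coeff x k j)) = (\<Sum>k<n'. ?p k * (x k * newton_coeff x k j))"
    unfolding n using n(2) by (simp add: newton_coeff_eq_0)
  also have "(\<Sum>k<n'. ?p (Suc k) * newton_coeff x k j) + \<dots> = y * (\<Sum>k<n'. ?p k * newton_coeff x k j)"
    by (simp add: sum_distrib_left algebra_simps flip: sum.distrib)
  also have "\<dots> = y ^ Suc j" using Suc.IH[OF n(2)] by simp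
  finally show ?case by simp
qed

lemma det_vandermonde:
  fixes x :: "nat \<Rightarrow> 'a::comm_ring_1"
  shows "det (mat n n (\<lambda>(i, j). x i ^ j)) = (\<Prod>i<n. \<Prod>l<i. x i - x l)"
proof -
  have "mat n n (\<lambda>(i, j). x i ^ j) =
      mat n n (\<lambda>(i, j). \<Sum>k<n. (\<Prod>l<k. x i - x l) * newton_coeff x k j)"
    by (rule eq_matI) (auto simp: power_eq_newton_sum[of _ n _ x])
  also have "det \<dots> = (\<Prod>i<n. (\<Prod>l<i. x i - x l) * newton_coeff x i i)"
  proof (rule det_lower_upper)
    show "(\<Prod>l<k. x i - x l) = 0" if "i < k" for i k
      by (rule prod_zero) (use that in auto)
  qed (rule newton_coeff_eq_0)
  finally show ?thesis by (simp add: newton_coeff_diag)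
qed

lemma det_qsum:
  fixes w :: "nat \<Rightarrow> nat \<Rightarrow> 'i \<Rightarrow> 'a::comm_ring_1"
  assumes "nonneg_finite_fibres I e"
  shows "det (mat m m (\<lambda>(j, b). qsum I e (w j b))) =
    qsum ({0..<m} \<rightarrow>\<^sub>E I) (\<lambda>z. \<Sum>j=0..<m. e (z j)) (\<lambda>z. det (mat m m (\<lambda>(j, b). w j b (z j))))"
  by (simp add: det_mat_leibniz prod_qsum assms qsum_sum qsum_cmult flip: fps_of_int)

lemma andreief:
  fixes u v :: "nat \<Rightarrow> 'i \<Rightarrow> 'a::comm_ring_1"
  assumes "nonneg_finite_fibres I e"
  shows "qsum ({0..<m} \<rightarrow>\<^sub>E I) (\<lambda>z. \<Sum>j=0..<m. e (z j))
      (\<lambda>z. det (mat m m (\<lambda>(j, a). u a (z j))) * det (mat m m (\<lambda>(j, b). v b (z j)))) =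
    of_nat (fact m) * det (mat m m (\<lambda>(a, b). qsum I e (\<lambda>i. u a i * v b i)))"
    (is "qsum ?T ?e _ = _ * ?D")
proof -
  let ?P = "{p. p permutes {0..<m}}"
  have expand: "det (mat m m (\<lambda>(j, a). u a (z j))) * det (mat m m (\<lambda>(j, b). v b (z j))) =
      (\<Sum>p\<in>?P. signof p * det (mat m m (\<lambda>(j, b). u (p j) (z j) * v b (z j))))" for z
  proof -
    have "det (mat m m (\<lambda>(j, b). u (p j) (z j) * v b (z j))) =
        (\<Prod>j<m. u (p j) (z j)) * det (mat m m (\<lambda>(j, b). v b (z j)))" for p
      using det_scale_rows_cols[of m "\<lambda>j. u (p j) (z j)" "\<lambda>_. 1"] by simp
    then show ?thesis
      by (simp add: det_mat_leibniz[of _ "\<lambda>(j, a). u a (z j)"] sum_distrib_right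
          lessThan_atLeast0 mult.assoc)
  qed
  have "qsum ?T ?e (\<lambda>z. det (mat m m (\<lambda>(j, a). u a (z j))) * det (mat m m (\<lambda>(j, b). v b (z j)))) =
      (\<Sum>p\<in>?P. signof p * det (mat m m (\<lambda>(j, b). qsum I e (\<lambda>i. u (p j) i * v b i))))"
    unfolding expand det_qsum[OF assms] by (simp add: qsum_sum qsum_cmult flip: fps_of_int)
  also have "\<dots> = (\<Sum>p\<in>?P. ?D)"
  proof (rule sum.cong[OF refl])
    fix p assume "p \<in> ?P"
    then have "det (mat m m (\<lambda>(j, b). qsum I e (\<lambda>i. u (p j) i * v b i))) = signof p * ?D"
      using det_mat_permute_rows[of p m "\<lambda>a b. qsum I e (\<lambda>i. u a i * v b i)"] by simp
    then show "signof p * det (mat m m (\<lambda>(j, b). qsum I e (\<lambda>i. u (p j) i * v b i))) = ?D"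
      by (simp flip: mult.assoc of_int_mult)
  qed
  also have "\<dots> = of_nat (fact m) * ?D" by (simp add: card_permutations[of _ m])
  finally show ?thesis .
qed

section \<open>Determinants of Taylor coefficients\<close>

lemma fps_shift_mult_X_power:
  assumes "\<And>i. i < n \<Longrightarrow> f $ i = 0"
  shows "fps_shift n f * fps_X ^ n = (f :: 'a::comm_ring_1 fps)"
  by (rule fps_ext) (simp add: fps_X_power_mult_right_nth assms)

lemma geometric_remainder:
  fixes K x y :: "'a::comm_ring_1"
  assumes "K * (1 - x) = y"
  shows "K = (\<Sum>k<n. y * x ^ k) + x ^ n * K"
proof -
  have "K * (1 - x ^ n) = y * (\<Sum>k<n. x ^ k)"
    unfolding one_diff_power_eq assms[symmetric] by (simp only: mult.assoc)
  then show ?thesis by (simp add: sum_distrib_left algebra_simps)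
qed

lemma rank_one_quotient_nth:
  fixes K :: "'a::comm_ring_1 fps fps" and P R T :: "'a fps"
  defines "S \<equiv> T * fps_X\<^sup>2"
  assumes K: "K * (1 - fps_tensor S S) = fps_tensor P R" and i: "i < 2 * n"
  shows "K $ j $ i = (\<Sum>k<n. (P * S ^ k) $ i * (R * S ^ k) $ j)"
proof -
  have "K = (\<Sum>k<n. fps_tensor P R * fps_tensor S S ^ k) + fps_tensor S S ^ n * K"
    by (rule geometric_remainder[OF K])
  also have "\<dots> = (\<Sum>k<n. fps_tensor (P * S ^ k) (R * S ^ k)) + fps_tensor (S ^ n) (S ^ n) * K"
    by (simp only: fps_tensor_power fps_tensor_mult)
  finally have "K $ j $ i = \<dots> $ j $ i" by (rule arg_cong)
  also have "\<dots> = (\<Sum>k<n. (P * S ^ k) $ i * (R * S ^ k) $ j) +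
      (fps_tensor (S ^ n) (S ^ n) * K) $ j $ i"
    by (simp add: fps_sum_nth)
  also have "(fps_tensor (S ^ n) (S ^ n) * K) $ j $ i = 0"
  proof -
    have "S ^ n = fps_X ^ (2 * n) * T ^ n" by (simp add: S_def power_mult_distrib power_mult)
    then have "(S ^ n) $ l = 0" if "l \<le> i" for l using that i by (simp add: fps_X_power_mult_nth)
    then show ?thesis
      by (simp add: fps_mult_nth[of "fps_tensor _ _"] fps_mult_nth[of "fps_tensor _ _ $ _"]
          fps_sum_nth)
  qed
  finally show ?thesis by simp
qed

lemma prod_power_square:
  "(\<Prod>k<n. c * (x ^ k * x ^ k)) = c ^ n * x ^ (n * (n - 1))" for x :: "'a::comm_monoid_mult"
proof (induction n)
  case (Suc n)
  have "Suc n * (Suc n - 1) = n * (n - 1) + n + n" by (cases n) auto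
  with Suc show ?case by (simp add: power_add mult_ac)
qed simp

lemma det_rank_one_quotient:
  fixes K :: "'a::comm_ring_1 fps fps" and P R T :: "'a fps"
  defines "S \<equiv> T * fps_X\<^sup>2"
  assumes K: "K * (1 - fps_tensor S S) = fps_tensor P R" and R: "R $ 0 = 0"
  shows "det (mat m m (\<lambda>(i, j). K $ (2 * j + 1) $ (2 * i))) =
    (P $ 0 * R $ 1) ^ m * (T $ 0) ^ (m * (m - 1))"
proof -
  let ?L = "\<lambda>i k. (P * S ^ k) $ (2 * i)" and ?U = "\<lambda>k j. (R * S ^ k) $ (2 * j + 1)"
  have nth: "(f * S ^ k) $ i = (if i < 2 * k then 0 else (f * T ^ k) $ (i - 2 * k))" for f k i
  proof -
    have "f * S ^ k = fps_X ^ (2 * k) * (f * T ^ k)"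
      by (simp add: S_def power_mult_distrib mult_ac flip: power_mult)
    then show ?thesis by (simp add: fps_X_power_mult_nth)
  qed
  have "mat m m (\<lambda>(i, j). K $ (2 * j + 1) $ (2 * i)) = mat m m (\<lambda>(i, j). \<Sum>k<m. ?L i k * ?U k j)"
    unfolding S_def
    by (rule eq_matI) (auto simp: rank_one_quotient_nth[OF K[unfolded S_def], of _ m])
  also have "det \<dots> = (\<Prod>k<m. ?L k k * ?U k k)"
    by (rule det_lower_upper) (simp_all add: nth)
  also have "\<dots> = (\<Prod>k<m. (P $ 0 * R $ 1) * ((T $ 0) ^ k * (T $ 0) ^ k))"
    by (rule prod.cong) (simp_all add: nth fps_mult_nth_1 R fps_power_zeroth mult_ac)
  also have "\<dots> = (P $ 0 * R $ 1) ^ m * (T $ 0) ^ (m * (m - 1))" by (rule prod_power_square)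
  finally show ?thesis .
qed

lemma rank_two_quotient_normal_form:
  fixes K :: "'a::comm_ring_1 fps fps" and A B h :: "'a fps"
  defines "\<alpha> \<equiv> A $ 0" and "\<beta> \<equiv> B $ 0"
  defines "a \<equiv> fps_const \<alpha> * A - fps_const \<beta> * B" and "b \<equiv> fps_const \<alpha> * B - fps_const \<beta> * A"
  assumes K: "K * (fps_tensor A A - fps_tensor B B) = fps_tensor 1 h" and a': "a * a' = 1"
  shows "K * (1 - fps_tensor (b * a') (b * a')) =
    fps_tensor (fps_const (\<alpha> * \<alpha> - \<beta> * \<beta>) * a') (h * a')"
proof -
  let ?\<Delta> = "fps_tensor (fps_const (\<alpha> * \<alpha> - \<beta> * \<beta>)) 1"
  have kernel: "fps_tensor a a - fps_tensor b b = ?\<Delta> * (fps_tensor A A - fps_tensor B B)"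
    unfolding right_diff_distrib fps_tensor_mult
    by (intro fps_ext) (simp add: a_def b_def algebra_simps)
  have "1 - fps_tensor (b * a') (b * a') =
      fps_tensor (a * a') (a * a') - fps_tensor (b * a') (b * a')"
    by (simp add: a')
  also have "\<dots> = (fps_tensor a a - fps_tensor b b) * fps_tensor a' a'"
    by (simp add: left_diff_distrib fps_tensor_mult)
  also have "K * \<dots> = fps_tensor 1 h * (?\<Delta> * fps_tensor a' a')"
    unfolding kernel K[symmetric] by (simp only: mult_ac)
  also have "\<dots> = fps_tensor (fps_const (\<alpha> * \<alpha> - \<beta> * \<beta>) * a') (h * a')"
    by (simp add: fps_tensor_mult)
  finally show ?thesis .
qed

lemma det_rank_two_quotient:
  fixes K :: "'a::comm_ring_1 fps fps" and A B h :: "'a fps"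
  assumes K: "K * (fps_tensor A A - fps_tensor B B) = fps_tensor 1 h"
    and nth_1: "A $ 1 = 0" "B $ 1 = 0" and h: "h $ 0 = 0"
    and unit: "(A $ 0 * A $ 0 - B $ 0 * B $ 0) * \<epsilon> = 1"
  shows "det (mat m m (\<lambda>(i, j). K $ (2 * j + 1) $ (2 * i))) =
    (h $ 1 * \<epsilon>) ^ m * ((A $ 0 * B $ 2 - B $ 0 * A $ 2) * \<epsilon>) ^ (m * (m - 1))"
proof -
  define \<Delta> where "\<Delta> = A $ 0 * A $ 0 - B $ 0 * B $ 0"
  define a b where "a = fps_const (A $ 0) * A - fps_const (B $ 0) * B"
    and "b = fps_const (A $ 0) * B - fps_const (B $ 0) * A"
  define a' where "a' = fps_right_inverse a \<epsilon>"
  have "a * a' = 1"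
    unfolding a'_def by (rule fps_right_inverse) (use unit in \<open>simp add: a_def\<close>)
  then have quotient: "K * (1 - fps_tensor (b * a') (b * a')) =
      fps_tensor (fps_const \<Delta> * a') (h * a')"
    unfolding a_def b_def \<Delta>_def by (rule rank_two_quotient_normal_form[OF K])
  have a'_nth: "a' $ 0 = \<epsilon>" by (simp add: a'_def)
  have b_nth: "b $ 0 = 0" "b $ 1 = 0" "b $ 2 = A $ 0 * B $ 2 - B $ 0 * A $ 2"
    using nth_1 by (simp_all add: b_def)
  then have shift: "b * a' = fps_shift 2 (b * a') * fps_X\<^sup>2"
    by (intro fps_shift_mult_X_power[symmetric]) (auto simp: fps_mult_nth less_2_cases_iff)
  have "fps_shift 2 (b * a') $ 0 = (A $ 0 * B $ 2 - B $ 0 * A $ 2) * \<epsilon>"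
    using b_nth by (simp add: fps_mult_nth numeral_2_eq_2 a'_nth)
  moreover have "(fps_const \<Delta> * a') $ 0 = 1" "(h * a') $ 0 = 0" "(h * a') $ 1 = h $ 1 * \<epsilon>"
    using unit h by (simp_all add: \<Delta>_def fps_mult_nth a'_nth)
  ultimately show ?thesis
    using det_rank_one_quotient[of K "fps_shift 2 (b * a')" _ _ m] quotient shift by simp
qed

section \<open>The moment determinant\<close>

definition quadruple_prod :: "real \<times> real \<Rightarrow> int" where
  "quadruple_prod = (\<lambda>(x, y). \<lfloor>4 * x * y\<rfloor>)"

definition half_odd_moment :: "nat \<Rightarrow> nat \<Rightarrow> real fps" where
  "half_odd_moment i j = qsum (half_odds \<times> half_odds) quadruple_prod
     (\<lambda>(x, y). (x - y) ^ (2 * i) / fact (2 * i) * ((x + y) ^ (2 * j + 1) / fact (2 * j + 1)))"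

lemma of_int_quadruple_prod:
  assumes "x \<in> half_odds" "y \<in> half_odds"
  shows "of_int (quadruple_prod (x, y)) = 4 * x * y"
proof -
  obtain k l where "x = 1/2 + real k" "y = 1/2 + real l" using assms by (auto simp: half_odds_def)
  then have "4 * x * y = of_int ((2 * int k + 1) * (2 * int l + 1))" by (simp add: algebra_simps)
  then show ?thesis unfolding quadruple_prod_def prod.case by (simp only: floor_of_int)
qed

lemma quadruple_prod_of_int: "quadruple_prod (of_int a + 1/2, of_int b + 1/2) = odd_prod (a, b)"
proof -
  have "4 * (real_of_int a + 1/2) * (of_int b + 1/2) = of_int (odd_prod (a, b))"
    by (simp add: odd_prod_def algebra_simps)
  then show ?thesis unfolding quadruple_prod_def prod.case by (simp only: floor_of_int)
qed

lemma bij_betw_half_odds: "bij_betw (\<lambda>a. real_of_int a + 1/2) {0..} half_odds"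
proof (rule bij_betw_imageI)
  show "(\<lambda>a. real_of_int a + 1/2) ` {0..} = half_odds"
  proof (intro equalityI subsetI)
    fix x assume "x \<in> half_odds"
    then obtain n where "x = of_int (int n) + 1/2" by (auto simp: half_odds_def)
    then show "x \<in> (\<lambda>a. real_of_int a + 1/2) ` {0..}" by (rule image_eqI) simp
  next
    fix x assume "x \<in> (\<lambda>a. real_of_int a + 1/2) ` {0..}"
    then obtain a :: int where "0 \<le> a" "x = 1/2 + real (nat a)" by auto
    then show "x \<in> half_odds" unfolding half_odds_def by blast
  qed
qed (simp add: inj_on_def)

lemma bij_betw_half_odd_pairs:
  "bij_betw (\<lambda>(a, b). (real_of_int a + 1/2, real_of_int b + 1/2)) ({0..} \<times> {0..})
    (half_odds \<times> half_odds)"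
  using bij_betw_map_prod[OF bij_betw_half_odds bij_betw_half_odds] by (simp add: map_prod_def)

lemma nonneg_finite_fibres_quadruple_prod:
  "nonneg_finite_fibres (half_odds \<times> half_odds) quadruple_prod"
proof -
  let ?f = "\<lambda>(a, b). (real_of_int a + 1/2, real_of_int b + 1/2)"
  let ?g = "inv_into ({0..} \<times> {0..}) ?f"
  have g: "bij_betw ?g (half_odds \<times> half_odds) ({0..} \<times> {0..})"
    by (rule bij_betw_inv_into[OF bij_betw_half_odd_pairs])
  have odd_prod: "odd_prod (?g z) = quadruple_prod z" if "z \<in> half_odds \<times> half_odds" for z
  proof -
    have "quadruple_prod (?f p) = odd_prod p" for p by (cases p) (simp add: quadruple_prod_of_int)
    from this[of "?g z"] show ?thesis
      by (simp only: bij_betw_inv_into_right[OF bij_betw_half_odd_pairs that])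
  qed
  have g_same_sign: "?g z \<in> same_sign" if "z \<in> half_odds \<times> half_odds" for z
    using bij_betwE[OF g] that unfolding same_sign_def by force
  show ?thesis
  proof (rule nonneg_finite_fibres_bound[OF nonneg_finite_fibres_odd_prod bij_betw_imp_inj_on[OF g]
        g_same_sign, where c = 1 and d = 0])
    fix z assume z: "z \<in> half_odds \<times> half_odds"
    show "0 \<le> quadruple_prod z"
      using exponent_nonneg[OF nonneg_finite_fibres_odd_prod g_same_sign[OF z]]
      by (simp only: odd_prod[OF z])
  qed (simp_all add: odd_prod)
qed

lemma half_odd_moment_int:
  "half_odd_moment i j = qsum ({0..} \<times> {0..}) odd_prod (\<lambda>(a, b).
     of_int (a - b) ^ (2 * i) / fact (2 * i) *
     (of_int (a + b + 1) ^ (2 * j + 1) / fact (2 * j + 1)))"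
  unfolding half_odd_moment_def
  by (rule qsum_reindex[OF bij_betw_half_odd_pairs, symmetric])
    (auto simp: quadruple_prod_of_int add_ac)

lemma half_odd_moment_0_0_nth: "half_odd_moment 0 0 $ 0 = 0" "half_odd_moment 0 0 $ 1 = 1"
proof -
  have "odd_prod z \<noteq> 0" for z
  proof -
    have "odd (odd_prod z)" by (cases z) (simp add: odd_prod_def)
    then show ?thesis by (metis even_zero)
  qed
  then show "half_odd_moment 0 0 $ 0 = 0" by (simp add: half_odd_moment_int qsum_nth)
  have "{z. z \<in> {0..} \<times> {0..} \<and> odd_prod z = 1} = {(0, 0)}"
    by (auto simp: odd_prod_def zmult_eq_1_iff)
  then show "half_odd_moment 0 0 $ 1 = 1" by (simp add: half_odd_moment_int qsum_nth)
qed

lemma qsum_cross_sgn_antisymmetric: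
  fixes w :: "int \<times> int \<Rightarrow> 'a::comm_ring_1"
  assumes "\<And>a b. w (- 1 - a, - 1 - b) = - w (a, b)"
  shows "qsum same_sign odd_prod (\<lambda>z. cross_sgn z * w z) = 2 * qsum ({0..} \<times> {0..}) odd_prod w"
proof -
  let ?reflect = "\<lambda>(a, b). (- 1 - a, - 1 - b) :: int \<times> int"
  have split: "same_sign = {0..} \<times> {0..} \<union> {..<0} \<times> {..<0}" by (auto simp: same_sign_def)
  have "qsum same_sign odd_prod (\<lambda>z. cross_sgn z * w z) =
      qsum ({0..} \<times> {0..}) odd_prod (\<lambda>z. cross_sgn z * w z) +
      qsum ({..<0} \<times> {..<0}) odd_prod (\<lambda>z. cross_sgn z * w z)"
    unfolding split
    by (rule qsum_Un_disjoint) (use nonneg_finite_fibres_odd_prod split in auto)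
  also have "qsum ({0..} \<times> {0..}) odd_prod (\<lambda>z. cross_sgn z * w z) =
      qsum ({0..} \<times> {0..}) odd_prod w"
    by (rule qsum_cong) (auto simp: cross_sgn_def)
  also have "qsum ({..<0} \<times> {..<0}) odd_prod (\<lambda>z. cross_sgn z * w z) =
      qsum ({0..} \<times> {0..}) odd_prod w"
  proof (rule qsum_reindex)
    show "bij_betw ?reflect ({..<0} \<times> {..<0}) ({0..} \<times> {0..})"
      by (rule bij_betw_byWitness[where f' = ?reflect]) auto
    show "odd_prod (?reflect z) = odd_prod z" for z
      by (cases z) (simp add: odd_prod_def algebra_simps)
    show "w (?reflect z) = cross_sgn z * w z" if "z \<in> {..<0} \<times> {..<0}" for z
      using that by (auto simp: cross_sgn_def assms)
  qed
  finally show ?thesis by simp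
qed

lemma kronecker_series_odd_even_nth:
  "kronecker_series $ (2 * j + 1) $ (2 * i) = 2 * half_odd_moment i j"
proof -
  let ?w = "\<lambda>(a, b). real_of_int (a - b) ^ (2 * i) / fact (2 * i) *
      (of_int (a + b + 1) ^ (2 * j + 1) / fact (2 * j + 1))"
  have "kronecker_series $ (2 * j + 1) $ (2 * i) = qsum same_sign odd_prod (\<lambda>z. cross_sgn z * ?w z)"
    unfolding kronecker_series_nth by (rule qsum_cong) (auto simp: mult.assoc)
  also have "\<dots> = 2 * qsum ({0..} \<times> {0..}) odd_prod ?w"
  proof (rule qsum_cross_sgn_antisymmetric)
    fix a b :: int
    have reflect: "- 1 - a - (- 1 - b) = - (a - b)" "- 1 - a + (- 1 - b) + 1 = - (a + b + 1)"
      by simp_all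
    have "(- p) ^ (2 * i) / c * ((- q) ^ (2 * j + 1) / d) =
        - (p ^ (2 * i) / c * (q ^ (2 * j + 1) / d))"
      for p q c d :: real by simp
    then show "?w (- 1 - a, - 1 - b) = - ?w (a, b)"
      unfolding prod.case reflect of_int_minus .
  qed
  finally show ?thesis by (simp only: half_odd_moment_int)
qed

lemma exp_theta_nth_0:
  "exp_theta_even $ 0 = theta_even (\<lambda>_. 1)" "exp_theta_odd $ 0 = theta_odd (\<lambda>_. 1)"
  by (simp_all add: exp_theta_even_nth exp_theta_odd_nth)

lemma exp_theta_nth_1: "exp_theta_even $ 1 = 0" "exp_theta_odd $ 1 = 0"
  unfolding exp_theta_even_nth exp_theta_odd_nth theta_even_def theta_odd_def
  by (rule qsum_involution_eq_0[where f = uminus]; simp)+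

lemma exp_theta_nth_2:
  "2 * exp_theta_even $ 2 = fps_XD (theta_even (\<lambda>_. 1))"
  "2 * exp_theta_odd $ 2 = fps_XD (theta_odd (\<lambda>_. 1))"
proof -
  have "2 * qsum I (\<lambda>k::int. k\<^sup>2) (\<lambda>k. of_int k ^ 2 / fact 2) =
      fps_XD (qsum I (\<lambda>k. k\<^sup>2) (\<lambda>_. 1 :: real))" for I
    unfolding fps_XD_qsum fps_numeral_fps_const qsum_cmult[symmetric] by (rule qsum_cong) auto
  then show "2 * exp_theta_even $ 2 = fps_XD (theta_even (\<lambda>_. 1))"
    "2 * exp_theta_odd $ 2 = fps_XD (theta_odd (\<lambda>_. 1))"
    by (simp_all add: exp_theta_even_nth exp_theta_odd_nth theta_even_def theta_odd_def)
qed

lemma exp_theta_wronskian_nth: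
  "exp_theta_wronskian $ 0 = 0"
  "exp_theta_wronskian $ 1 =
    2 * (exp_theta_even $ 0 * exp_theta_odd $ 2 - exp_theta_odd $ 0 * exp_theta_even $ 2)"
  by (simp_all add: exp_theta_wronskian_def fps_mult_nth_1 exp_theta_nth_1[simplified]
      numeral_2_eq_2 algebra_simps)

lemma exp_theta_wronskian_nth_1_eq:
  "exp_theta_wronskian $ 1 = XD_wronskian (theta_even (\<lambda>_. 1)) (theta_odd (\<lambda>_. 1))"
  unfolding exp_theta_wronskian_nth XD_wronskian_def exp_theta_nth_2[symmetric] exp_theta_nth_0
  by (simp add: algebra_simps)

lemma half_odd_moment_0_0_wronskian:
  "2 * half_odd_moment 0 0 * ((theta_even (\<lambda>_. 1))\<^sup>2 - (theta_odd (\<lambda>_. 1))\<^sup>2) =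
    XD_wronskian (theta_even (\<lambda>_. 1)) (theta_odd (\<lambda>_. 1))"
proof -
  let ?\<Theta> = "fps_tensor exp_theta_even exp_theta_even - fps_tensor exp_theta_odd exp_theta_odd"
  have \<Theta>: "?\<Theta> $ 1 $ 0 = 0" "?\<Theta> $ 0 $ 0 = (theta_even (\<lambda>_. 1))\<^sup>2 - (theta_odd (\<lambda>_. 1))\<^sup>2"
    by (simp_all add: exp_theta_nth_0 exp_theta_nth_1[simplified] power2_eq_square)
  have "(kronecker_series * ?\<Theta>) $ 1 $ 0 =
      kronecker_series $ 0 $ 0 * ?\<Theta> $ 1 $ 0 + kronecker_series $ 1 $ 0 * ?\<Theta> $ 0 $ 0"
    by (simp only: fps_mult_nth_1 fps_add_nth fps_mult_nth_0)
  also have "\<dots> = 2 * half_odd_moment 0 0 * ((theta_even (\<lambda>_. 1))\<^sup>2 - (theta_odd (\<lambda>_. 1))\<^sup>2)"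
    unfolding \<Theta> using kronecker_series_odd_even_nth[of 0 0] by simp
  finally show ?thesis
    unfolding kronecker_series_mult_theta fps_tensor_nth exp_theta_wronskian_nth_1_eq by simp
qed

lemma half_odd_moment_0_0_eq: "half_odd_moment 0 0 = fps_X * triangle_series (qpow 1) ^ 4"
  by (rule theta_wronskian_quotient[OF half_odd_moment_0_0_wronskian half_odd_moment_0_0_nth])

lemma det_half_odd_moment:
  "det (mat m m (\<lambda>(i, j). half_odd_moment i j)) = half_odd_moment 0 0 ^ (m\<^sup>2)"
proof -
  let ?A = exp_theta_even and ?B = exp_theta_odd and ?s = "half_odd_moment 0 0"
  define \<Delta> where "\<Delta> = ?A $ 0 * ?A $ 0 - ?B $ 0 * ?B $ 0"
  have "\<Delta> $ 0 = 1"
    by (simp add: \<Delta>_def exp_theta_nth_0 theta_even_1 theta_odd_1 theta_squares_nth_0)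
  then have unit: "\<Delta> * inverse \<Delta> = 1" by (intro inverse_mult_eq_1') simp
  have wronskian: "exp_theta_wronskian $ 1 = 2 * ?s * \<Delta>"
    unfolding exp_theta_wronskian_nth_1_eq half_odd_moment_0_0_wronskian[symmetric]
    by (simp add: \<Delta>_def exp_theta_nth_0 power2_eq_square)
  then have "2 * (?A $ 0 * ?B $ 2 - ?B $ 0 * ?A $ 2) = 2 * (?s * \<Delta>)"
    unfolding exp_theta_wronskian_nth(2) by (simp only: mult.assoc)
  then have numerator: "?A $ 0 * ?B $ 2 - ?B $ 0 * ?A $ 2 = ?s * \<Delta>"
    unfolding mult_cancel_left by simp
  have "2 ^ m * det (mat m m (\<lambda>(i, j). half_odd_moment i j)) =
      det (mat m m (\<lambda>(i, j). kronecker_series $ (2 * j + 1) $ (2 * i)))"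
    unfolding kronecker_series_odd_even_nth
    using det_scale_rows_cols[of m "\<lambda>_. 2" "\<lambda>_. 1" half_odd_moment] by simp
  also have "\<dots> = (exp_theta_wronskian $ 1 * inverse \<Delta>) ^ m *
      ((?A $ 0 * ?B $ 2 - ?B $ 0 * ?A $ 2) * inverse \<Delta>) ^ (m * (m - 1))"
    using kronecker_series_mult_theta exp_theta_nth_1 exp_theta_wronskian_nth(1)
      unit[unfolded \<Delta>_def]
    unfolding \<Delta>_def by (rule det_rank_two_quotient)
  also have "\<dots> = (2 * ?s) ^ m * ?s ^ (m * (m - 1))"
    unfolding wronskian numerator mult.assoc unit mult_1_right ..
  also have "\<dots> = 2 ^ m * ?s ^ (m\<^sup>2)"
    by (cases m) (simp_all add: power_mult_distrib power2_eq_square power_add mult_ac)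
  finally show ?thesis unfolding mult_cancel_left by simp
qed

section \<open>The sum over half-odd tuples\<close>

lemma prod_pairs_reindex:
  fixes h :: "nat \<Rightarrow> nat \<Rightarrow> 'a::comm_monoid_mult"
  shows "(\<Prod>i=1..m. \<Prod>j=i+1..m. h i j) = (\<Prod>i<m. \<Prod>l<i. h (Suc l) (Suc i))"
proof (induction m)
  case (Suc m)
  have "(\<Prod>i=1..Suc m. \<Prod>j=i+1..Suc m. h i j) = (\<Prod>i=1..m. (\<Prod>j=i+1..m. h i j) * h i (Suc m))"
    by (simp add: prod.cl_ivl_Suc mult.commute)
  also have "\<dots> = (\<Prod>i=1..m. \<Prod>j=i+1..m. h i j) * (\<Prod>i=1..m. h i (Suc m))"
    by (rule prod.distrib)
  also have "(\<Prod>i=1..m. h i (Suc m)) = (\<Prod>l<m. h (Suc l) (Suc m))"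
    by (simp add: prod.atLeast1_atMost_eq)
  finally show ?case using Suc by simp
qed simp

lemma det_scaled_vandermonde:
  fixes x c d :: "nat \<Rightarrow> 'a::field"
  shows "det (mat n n (\<lambda>(i, j). c i * (x i ^ j / d j))) =
    (\<Prod>i<n. c i) * (\<Prod>i<n. \<Prod>l<i. x i - x l) / (\<Prod>j<n. d j)"
proof -
  have "det (mat n n (\<lambda>(i, j). c i * (x i ^ j / d j))) =
      det (mat n n (\<lambda>(i, j). c i * (1 / d j) * x i ^ j))"
    by simp
  also have "\<dots> = (\<Prod>i<n. c i) * (\<Prod>i<n. \<Prod>l<i. x i - x l) / (\<Prod>j<n. d j)"
    unfolding det_scale_rows_cols det_vandermonde by (simp add: prod_dividef)
  finally show ?thesis .
qed

lemma f_weight_eq_vandermonde: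
  "f_weight m x y = (\<Prod>i<m. \<Prod>l<i. (x (Suc i) - y (Suc i))\<^sup>2 - (x (Suc l) - y (Suc l))\<^sup>2) *
    ((\<Prod>j<m. x (Suc j) + y (Suc j)) *
     (\<Prod>i<m. \<Prod>l<i. (x (Suc i) + y (Suc i))\<^sup>2 - (x (Suc l) + y (Suc l))\<^sup>2))"
proof -
  have swap: "(p - q) * (r - s) = (q - p) * (s - r)" for p q r s :: real
    by (simp add: algebra_simps)
  have "(\<Prod>j=1..m. x j + y j) = (\<Prod>j<m. x (Suc j) + y (Suc j))"
    by (simp add: prod.atLeast1_atMost_eq)
  then show ?thesis
    unfolding f_weight_def prod_pairs_reindex
    by (subst swap) (simp add: prod.distrib mult_ac)
qed

lemma f_weight_eq_det:
  "f_weight m x y = (\<Prod>i<m. fact (2 * i) * fact (2 * i + 1)) *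
    (det (mat m m (\<lambda>(j, a). (x (Suc j) - y (Suc j)) ^ (2 * a) / fact (2 * a))) *
     det (mat m m (\<lambda>(j, b). (x (Suc j) + y (Suc j)) ^ (2 * b + 1) / fact (2 * b + 1))))"
proof -
  let ?d = "\<lambda>j. x (Suc j) - y (Suc j)" and ?s = "\<lambda>j. x (Suc j) + y (Suc j)"
  have even: "det (mat m m (\<lambda>(j, a). ?d j ^ (2 * a) / fact (2 * a))) =
      (\<Prod>i<m. \<Prod>l<i. (?d i)\<^sup>2 - (?d l)\<^sup>2) / (\<Prod>a<m. fact (2 * a))"
    using det_scaled_vandermonde[of m "\<lambda>_. 1" "\<lambda>j. (?d j)\<^sup>2" "\<lambda>a. fact (2 * a)"]
    by (simp add: power_mult)
  have odd: "det (mat m m (\<lambda>(j, b). ?s j ^ (2 * b + 1) / fact (2 * b + 1))) =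
      (\<Prod>j<m. ?s j) * (\<Prod>i<m. \<Prod>l<i. (?s i)\<^sup>2 - (?s l)\<^sup>2) / (\<Prod>b<m. fact (2 * b + 1))"
    using det_scaled_vandermonde[of m ?s "\<lambda>j. (?s j)\<^sup>2" "\<lambda>b. fact (2 * b + 1)"]
    by (simp add: power_mult)
  show ?thesis
    unfolding even odd f_weight_eq_vandermonde by (simp add: prod.distrib)
qed

lemma half_odd_tuples_nth: "x \<in> half_odd_tuples m \<Longrightarrow> j < m \<Longrightarrow> x (Suc j) \<in> half_odds"
  unfolding half_odd_tuples_def by (rule PiE_mem[of x "{1..m}"]) auto

lemma bij_betw_half_odd_tuples:
  "bij_betw (\<lambda>(x, y). \<lambda>i\<in>{0..<m}. (x (Suc i), y (Suc i)))
    (half_odd_tuples m \<times> half_odd_tuples m) ({0..<m} \<rightarrow>\<^sub>E half_odds \<times> half_odds)"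
  (is "bij_betw ?f ?H ?T")
proof (rule bij_betw_byWitness)
  let ?g = "\<lambda>z. (\<lambda>j\<in>{1..m}. fst (z (j - 1)), \<lambda>j\<in>{1..m}. snd (z (j - 1)))"
  show "\<forall>p\<in>?H. ?g (?f p) = p"
  proof
    fix p assume "p \<in> ?H"
    then obtain x y where p: "p = (x, y)" "x \<in> half_odd_tuples m" "y \<in> half_odd_tuples m" by auto
    then have restrict: "restrict x {1..m} = x" "restrict y {1..m} = y"
      unfolding half_odd_tuples_def by (auto intro: PiE_restrict)
    have "?g (?f p) = (restrict x {1..m}, restrict y {1..m})" by (auto simp: p fun_eq_iff)
    then show "?g (?f p) = p" by (simp only: restrict p)
  qed
  show "\<forall>z\<in>?T. ?f (?g z) = z"
    by (auto simp: fun_eq_iff PiE_def extensional_def)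
  show "?f ` ?H \<subseteq> ?T" by (auto simp: half_odd_tuples_nth)
  show "?g ` ?T \<subseteq> ?H"
  proof (rule image_subsetI)
    fix z assume "z \<in> ?T"
    then have "z (j - 1) \<in> half_odds \<times> half_odds" if "j \<in> {1..m}" for j
      using that by (intro PiE_mem[of z]) auto
    then show "?g z \<in> ?H" by (auto simp: half_odd_tuples_def mem_Times_iff)
  qed
qed

lemma qpow_half_odd_tuples:
  assumes "x \<in> half_odd_tuples m" "y \<in> half_odd_tuples m"
  shows "qpow (2 * (\<Sum>j=1..m. x j * y j)) =
    fps_X ^ nat (\<Sum>j=0..<m. quadruple_prod (x (Suc j), y (Suc j)))"
proof -
  have "2 * (2 * (\<Sum>j=1..m. x j * y j)) = (\<Sum>j<m. 4 * x (Suc j) * y (Suc j))"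
    by (simp add: sum.atLeast1_atMost_eq sum_distrib_left mult.assoc)
  also have "\<dots> = (\<Sum>j<m. of_int (quadruple_prod (x (Suc j), y (Suc j))))"
    by (rule sum.cong) (simp_all add: of_int_quadruple_prod half_odd_tuples_nth[OF assms(1)]
        half_odd_tuples_nth[OF assms(2)])
  also have "\<dots> = of_int (\<Sum>j=0..<m. quadruple_prod (x (Suc j), y (Suc j)))"
    by (simp add: lessThan_atLeast0)
  finally show ?thesis unfolding qpow_def by (simp only: floor_of_int)
qed

lemma qsum_f_weight:
  "qsum ({0..<m} \<rightarrow>\<^sub>E half_odds \<times> half_odds) (\<lambda>z. \<Sum>j=0..<m. quadruple_prod (z j))
      (\<lambda>z. f_weight m (\<lambda>j. fst (z (j - 1))) (\<lambda>j. snd (z (j - 1)))) =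
    fps_const ((\<Prod>i<m. fact (2 * i) * fact (2 * i + 1)) * fact m) * half_odd_moment 0 0 ^ (m\<^sup>2)"
    (is "qsum ?T ?e ?f = _")
proof -
  let ?C = "\<Prod>i<m. fact (2 * i) * fact (2 * i + 1) :: real"
  let ?u = "\<lambda>a p. (fst p - snd p) ^ (2 * a) / fact (2 * a) :: real"
  let ?v = "\<lambda>b p. (fst p + snd p) ^ (2 * b + 1) / fact (2 * b + 1) :: real"
  have "?f = (\<lambda>z. ?C * (det (mat m m (\<lambda>(j, a). ?u a (z j))) * det (mat m m (\<lambda>(j, b). ?v b (z j)))))"
    unfolding f_weight_eq_det diff_Suc_1 ..
  then have "qsum ?T ?e ?f = fps_const ?C * (of_nat (fact m) *
      det (mat m m (\<lambda>(a, b). qsum (half_odds \<times> half_odds) quadruple_prod (\<lambda>p. ?u a p * ?v b p))))"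
    using andreief[OF nonneg_finite_fibres_quadruple_prod, of m ?u ?v] by (simp only: qsum_cmult)
  also have "(\<lambda>(a, b). qsum (half_odds \<times> half_odds) quadruple_prod (\<lambda>p. ?u a p * ?v b p)) =
      (\<lambda>(i, j). half_odd_moment i j)"
    by (simp add: half_odd_moment_def case_prod_unfold)
  also have "of_nat (fact m) = fps_const (fact m :: real)" by (simp flip: fps_of_nat)
  finally show ?thesis by (simp only: det_half_odd_moment mult.assoc flip: fps_const_mult)
qed

lemma f_weight_cong:
  assumes "\<And>j. j \<in> {1..m} \<Longrightarrow> x j = x' j" "\<And>j. j \<in> {1..m} \<Longrightarrow> y j = y' j"
  shows "f_weight m x y = f_weight m x' y'"
  unfolding f_weight_def
  by (intro arg_cong2[where f = "(*)"] prod.cong refl) (simp_all add: assms)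

lemma has_sum_half_odd_tuples:
  "((\<lambda>(x, y). fps_const (f_weight m x y) * qpow (2 * (\<Sum>j=1..m. x j * y j))) has_sum
    fps_const ((\<Prod>i<m. fact (2 * i) * fact (2 * i + 1)) * fact m) * half_odd_moment 0 0 ^ (m\<^sup>2))
    (half_odd_tuples m \<times> half_odd_tuples m)" (is "(_ has_sum ?S) ?H")
proof -
  let ?T = "{0..<m} \<rightarrow>\<^sub>E half_odds \<times> half_odds"
  let ?e = "\<lambda>z. \<Sum>j=0..<m. quadruple_prod (z j)"
  let ?w = "\<lambda>z. f_weight m (\<lambda>j. fst (z (j - 1))) (\<lambda>j. snd (z (j - 1)))"
  let ?zip = "\<lambda>(x, y). \<lambda>i\<in>{0..<m}. (x (Suc i), y (Suc i))"
  have "nonneg_finite_fibres ?T ?e"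
    by (rule nonneg_finite_fibres_PiE[OF _ nonneg_finite_fibres_quadruple_prod]) simp
  then have "((\<lambda>z. fps_const (?w z) * fps_X ^ nat (?e z)) has_sum ?S) ?T"
    unfolding qsum_f_weight[symmetric] by (rule has_sum_qsum)
  then have "((\<lambda>p. fps_const (?w (?zip p)) * fps_X ^ nat (?e (?zip p))) has_sum ?S) ?H"
    by (rule has_sum_reindex_bij_betw[OF bij_betw_half_odd_tuples, THEN iffD2])
  then show ?thesis
  proof (rule has_sum_cong[THEN iffD1, rotated])
    fix p assume "p \<in> ?H"
    then obtain x y where p: "p = (x, y)" and xy: "x \<in> half_odd_tuples m" "y \<in> half_odd_tuples m"
      by auto
    have weight: "?w (?zip p) = f_weight m x y" by (rule f_weight_cong) (auto simp: p)
    have exponent: "?e (?zip p) = (\<Sum>j=0..<m. quadruple_prod (x (Suc j), y (Suc j)))"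
      by (simp add: p)
    show "fps_const (?w (?zip p)) * fps_X ^ nat (?e (?zip p)) =
        (case p of (x, y) \<Rightarrow> fps_const (f_weight m x y) * qpow (2 * (\<Sum>j=1..m. x j * y j)))"
      unfolding weight exponent unfolding p prod.case qpow_half_odd_tuples[OF xy] ..
  qed
qed

lemma prod_fact_even_squared:
  "(\<Prod>j=1..m. (fact (2 * j))\<^sup>2 :: real) =
    2 ^ m * fact (2 * m) * ((\<Prod>i<m. fact (2 * i) * fact (2 * i + 1)) * fact m)"
proof (induction m)
  case (Suc m)
  have fact_step: "(fact (2 * Suc m) :: real) = 2 * (1 + real m) * fact (2 * m + 1)"
    by (simp add: algebra_simps)
  have "(\<Prod>j=1..Suc m. (fact (2 * j))\<^sup>2 :: real) =
      (\<Prod>j=1..m. (fact (2 * j))\<^sup>2) * (fact (2 * Suc m) * fact (2 * Suc m))"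
    by (simp add: power2_eq_square del: fact_Suc)
  also have "\<dots> = (\<Prod>j=1..m. (fact (2 * j))\<^sup>2) *
      (fact (2 * Suc m) * (2 * (1 + real m) * fact (2 * m + 1)))"
    by (simp only: fact_step)
  also have "\<dots> = 2 ^ Suc m * fact (2 * Suc m) *
      ((\<Prod>i<Suc m. fact (2 * i) * fact (2 * i + 1)) * fact (Suc m))"
    unfolding Suc by (simp only: prod.lessThan_Suc power_Suc fact_Suc[of m] of_nat_Suc mult_ac)
  finally show ?case .
qed simp

theorem theorem1p2:
  fixes m :: nat
  assumes "m \<ge> 1"
  shows "qpow (real (m\<^sup>2) / 2) * triangle_series (qpow 1) ^ (4 * m\<^sup>2) =
    fps_const (2 ^ m * fact (2 * m) / (\<Prod>j=1..m. (fact (2 * j))\<^sup>2)) *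
    (\<Sum>\<^sub>\<infinity>(x, y) \<in> half_odd_tuples m \<times> half_odd_tuples m.
       fps_const (f_weight m x y) * qpow (2 * (\<Sum>j=1..m. x j * y j)))"
proof -
  let ?C = "(\<Prod>i<m. fact (2 * i) * fact (2 * i + 1)) * fact m :: real"
  let ?c = "2 ^ m * fact (2 * m) / (\<Prod>j=1..m. (fact (2 * j))\<^sup>2) :: real"
  have "(\<Prod>j=1..m. (fact (2 * j))\<^sup>2) \<noteq> (0 :: real)" by simp
  then have "?c * ?C = 1" unfolding prod_fact_even_squared
    by (subst times_divide_eq_left) (rule divide_self)
  then have "fps_const ?c * (fps_const ?C * half_odd_moment 0 0 ^ (m\<^sup>2)) =
      half_odd_moment 0 0 ^ (m\<^sup>2)"
    by (simp add: mult.assoc[symmetric])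
  also have "\<dots> = qpow (real (m\<^sup>2) / 2) * triangle_series (qpow 1) ^ (4 * m\<^sup>2)"
    unfolding half_odd_moment_0_0_eq power_mult_distrib power_mult qpow_half_of_nat ..
  finally show ?thesis
    unfolding infsumI[OF has_sum_half_odd_tuples] by simp
qed

end
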